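(* Let $G_m$ be a bounded Vilenkin group. There is a constant $c<\infty$ (depending only on $m$) such that for every martingale $f\in H_{1/2}(G_m)$, $$\Big\|\sup_{n\in P_+}\frac{|\sigma_n f|}{\log^2(n+1)}\Big\|_{L_{1/2}(G_m)}\le c\,\|f\|_{H_{1/2}(G_m)} .$$ That is, the maximal operator $\widetilde\sigma^*f:=\sup_{n\in P_+}\frac{|\sigma_nf|}{\log^2(n+1)}$ is bounded from $H_{1/2}(G_m)$ to $L_{1/2}(G_m)$.
   Context: Let $P_+$ be the positive integers and $P=P_+\cup\{0\}$. Let $m=(m_0,m_1,\dots)$ be a sequence of integers $m_k\ge 2$ with $\sup_k m_k<\infty$ (bounded Vilenkin group). $G_m$ is the complete direct product of the cyclic groups $Z_{m_k}=\{0,1,\dots,m_k-1\}$ (addition mod $m_k$), with product of discrete topologies and Haar measure $\mu$ = product of the uniform probability measures on $Z_{m_k}$; elements are $x=(x_0,x_1,\dots)$, $x_k\in Z_{m_k}$, and $x-t$ is coordinatewise subtraction mod $m_k$. Put $M_0=1$, $M_{k+1}=m_kM_k$. For $x\in G_m$, $I_0(x)=G_m$, $I_n(x)=\{y: y_j=x_j,\ 0\le j<n\}$, $I_n:=I_n(0)$. Every $n\in P$ is written uniquely as $n=\sum_j n_jM_j$ with $n_j\in Z_{m_j}$. Rademacher functions $r_k(x)=\exp(2\pi i x_k/m_k)$; Vilenkin system $\psi_n=\prod_k r_k^{n_k}$. Let $\mathcal F_n$ be the $\sigma$-algebra generated by the sets $I_n(x)$. For a martingale $f=(f^{(n)})_{n\in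 P}$ with respect to $(\mathcal F_n)$, $f^*=\sup_n|f^{(n)}|$, and for $0<p<\infty$ the Hardy space $H_p(G_m)$ consists of martingales with $\|f\|_{H_p}:=\|f^*\|_{L_p}<\infty$, where $\|g\|_{L_p}=(\int_{G_m}|g|^pd\mu)^{1/p}$. Fourier coefficients of a martingale: $\hat f(i)=\lim_{k\to\infty}\int_{G_m}f^{(k)}\overline{\psi_i}\,d\mu$. Partial sums $S_nf=\sum_{k=0}^{n-1}\hat f(k)\psi_k$ ($S_0f=0$), Fejér means $\sigma_nf=\frac1n\sum_{k=0}^{n-1}S_kf$ ($n\in P_+$). $\log$ denotes a fixed logarithm (e.g. natural). *)

theory Defs
  imports "HOL-Probability.Probability"
begin

(* The Vilenkin group G_m: x = (x_0,x_1,...), x_k in Z_{m_k} = {0..<m k},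
   with the product of the uniform probability measures. *)
definition vG :: "(nat \<Rightarrow> nat) \<Rightarrow> (nat \<Rightarrow> nat) measure" where
  "vG m = (\<Pi>\<^sub>M k\<in>UNIV. uniform_count_measure {..<m k})"

definition vM :: "(nat \<Rightarrow> nat) \<Rightarrow> nat \<Rightarrow> nat" where
  "vM m k = (\<Prod>j<k. m j)"

definition vI :: "(nat \<Rightarrow> nat) \<Rightarrow> nat \<Rightarrow> (nat \<Rightarrow> nat) \<Rightarrow> (nat \<Rightarrow> nat) set" where
  "vI m n x = {y \<in> space (vG m). \<forall>j<n. y j = x j}"

definition vF :: "(nat \<Rightarrow> nat) \<Rightarrow> nat \<Rightarrow> (nat \<Rightarrow> nat) measure" where
  "vF m n = sigma (space (vG m)) {vI m n x | x. x \<in> space (vG m)}"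

(* digits n_k of n = sum_k n_k M_k *)
definition vdigit :: "(nat \<Rightarrow> nat) \<Rightarrow> nat \<Rightarrow> nat \<Rightarrow> nat" where
  "vdigit m n k = (n div vM m k) mod m k"

definition vr :: "(nat \<Rightarrow> nat) \<Rightarrow> nat \<Rightarrow> (nat \<Rightarrow> nat) \<Rightarrow> complex" where
  "vr m k x = exp (2 * of_real pi * \<i> * of_nat (x k) / of_nat (m k))"

(* Vilenkin functions psi_n = prod_k r_k^{n_k} (only finitely many n_k are nonzero) *)
definition vpsi :: "(nat \<Rightarrow> nat) \<Rightarrow> nat \<Rightarrow> (nat \<Rightarrow> nat) \<Rightarrow> complex" where
  "vpsi m n x = (\<Prod>k\<in>{k. vdigit m n k \<noteq> 0}. vr m k x ^ vdigit m n k)"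

(* martingales with respect to (F_n): adapted, integrable, and
   E(f^(n+1) | F_n) = f^(n), i.e. equal integrals over every set of F_n *)
definition vmartingale :: "(nat \<Rightarrow> nat) \<Rightarrow> (nat \<Rightarrow> (nat \<Rightarrow> nat) \<Rightarrow> complex) \<Rightarrow> bool" where
  "vmartingale m f \<longleftrightarrow>
     (\<forall>n. f n \<in> borel_measurable (vF m n)) \<and>
     (\<forall>n. integrable (vG m) (f n)) \<and>
     (\<forall>n A. A \<in> sets (vF m n) \<longrightarrow>
        (LINT x:A|vG m. f (Suc n) x) = (LINT x:A|vG m. f n x))"

definition vfourier :: "(nat \<Rightarrow> nat) \<Rightarrow> (nat \<Rightarrow> (nat \<Rightarrow> nat) \<Rightarrow> complex) \<Rightarrow> nat \<Rightarrow> complex" where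
  "vfourier m f i = lim (\<lambda>k. LINT x|vG m. f k x * cnj (vpsi m i x))"

definition vS :: "(nat \<Rightarrow> nat) \<Rightarrow> (nat \<Rightarrow> (nat \<Rightarrow> nat) \<Rightarrow> complex) \<Rightarrow> nat \<Rightarrow> (nat \<Rightarrow> nat) \<Rightarrow> complex" where
  "vS m f n x = (\<Sum>k<n. vfourier m f k * vpsi m k x)"

definition vsigma :: "(nat \<Rightarrow> nat) \<Rightarrow> (nat \<Rightarrow> (nat \<Rightarrow> nat) \<Rightarrow> complex) \<Rightarrow> nat \<Rightarrow> (nat \<Rightarrow> nat) \<Rightarrow> complex" where
  "vsigma m f n x = (\<Sum>k<n. vS m f k x) / of_nat n"

(* a^p for a in [0,\<infinity>], p > 0 *)
definition enn_powr :: "ennreal \<Rightarrow> real \<Rightarrow> ennreal" where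
  "enn_powr a p = (if a = \<infinity> then \<infinity> else ennreal (enn2real a powr p))"

definition vLp :: "(nat \<Rightarrow> nat) \<Rightarrow> real \<Rightarrow> ((nat \<Rightarrow> nat) \<Rightarrow> ennreal) \<Rightarrow> ennreal" where
  "vLp m p g = enn_powr (\<integral>\<^sup>+ x. enn_powr (g x) p \<partial>vG m) (1 / p)"

definition vmax :: "(nat \<Rightarrow> (nat \<Rightarrow> nat) \<Rightarrow> complex) \<Rightarrow> (nat \<Rightarrow> nat) \<Rightarrow> ennreal" where
  "vmax f x = (SUP n. ennreal (cmod (f n x)))"

definition vHp :: "(nat \<Rightarrow> nat) \<Rightarrow> real \<Rightarrow> (nat \<Rightarrow> (nat \<Rightarrow> nat) \<Rightarrow> complex) \<Rightarrow> ennreal" where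
  "vHp m p f = vLp m p (vmax f)"

definition vsigma_tilde :: "(nat \<Rightarrow> nat) \<Rightarrow> (nat \<Rightarrow> (nat \<Rightarrow> nat) \<Rightarrow> complex) \<Rightarrow> (nat \<Rightarrow> nat) \<Rightarrow> ennreal" where
  "vsigma_tilde m f x = (SUP n\<in>{1..}. ennreal (cmod (vsigma m f n x) / (ln (real n + 1))\<^sup>2))"

end

theory Submission
  imports Defs
begin

text \<open>
  Stopping the martingale at the first entrance to the cells on which the next step exceeds
  \<open>c = \<epsilon> 4^i\<close> gives martingales bounded by \<open>c\<close>; the differences of two consecutive ones split
  into atoms \<open>a\<close>, that is, mean zero functions of size at most \<open>5c\<close> living on cells \<open>I_N(u)\<close> whose total
  measure is comparable to \<open>\<mu>{f^* > c}\<close>. An atom has \<open>\<sigma>_n a = 0\<close> for \<open>n \<le> M_N\<close>. For larger \<open>n\<close> the bound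
  \<open>|n K_n(x - t)| \<lesssim> \<Sum>_{k < s} M_s M_k [x_i = t_i for all i < s, i \<noteq> k]\<close> shows that, off the cell,
  \<open>|\<sigma>_n a|^{1/2}\<close> is dominated, uniformly in \<open>n\<close>, by a function of integral \<open>\<lesssim> (N + 1) c^{1/2} \<mu>(I_N(u))\<close>.
  The loss \<open>N + 1\<close> is at most a multiple of \<open>log (n + 1)\<close>, so the weight absorbs it, and summing over all
  cells and \<open>i\<close> gives a multiple of \<open>\<integral>(f^*)^{1/2}\<close>.
\<close>

text \<open>The loss N + 1 is the effect of the exponent 1/2: the square root of the kernel bound
  has one row for each s <= N, and the bounds on the row integrals do not decay in s. The squared
  logarithm becomes a first power under the root, and subadditivity of the root replaces the
  triangle inequality, so that one majorant, free of n, can be summed over all atoms. The stopping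
  rule looks one step ahead. This prevents overshoot and costs a factor \<open>B\<close>: a cell is
  rejected as soon as one of its at most \<open>B\<close> children is bad. f need not come from an
  integrable function, so L is fixed first: f L has finitely many values and determines sigma_n f
  for n <= M_L. The levels cannot start at 0; what is left below \<open>e\<close> is estimated with
  a loss of M_L, and \<open>e\<close> is chosen after L to make it negligible. Ratio 4 makes the
  roots of the levels powers of 2 up to a factor, hence geometrically summable. No constant depends
  on L, which tends to infinity at the end.\<close>

section \<open>Square roots, geometric sums and suprema in \<open>ennreal\<close>\<close>

lemma sqrt_sum_le:
  fixes g :: "'i \<Rightarrow> real"
  assumes "\<And>i. i \<in> I \<Longrightarrow> g i \<ge> 0"
  shows "sqrt (\<Sum>i\<in>I. g i) \<le> (\<Sum>i\<in>I. sqrt (g i))"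
  using assms
proof (induction I rule: infinite_finite_induct)
  case (insert i I)
  have "sqrt (g i + sum g I) \<le> sqrt (g i) + sqrt (sum g I)"
    using insert.prems by (intro sqrt_add_le_add_sqrt sum_nonneg) auto
  also have "\<dots> \<le> sqrt (g i) + (\<Sum>i\<in>I. sqrt (g i))"
    using insert by (intro add_left_mono insert.IH) auto
  finally show ?case using insert.hyps by simp
qed auto

text \<open>A geometric sum is at most twice its last term, and that term is below z. With z = sqrt
  (f^* / e) this becomes a discrete layer-cake bound over the levels
  \<open>e * 4 ^ i\<close>.\<close>

lemma sum_powers_below_le:
  fixes z :: real
  assumes "z \<ge> 0"
  shows "(\<Sum>i<K. if 2 ^ i < z then 2 ^ i else 0) \<le> 2 * z"
proof (induction K)
  case (Suc K)
  show ?case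
  proof (cases "2 ^ K < z")
    case True
    have "(\<Sum>i<Suc K. if 2 ^ i < z then 2 ^ i else 0) \<le> (\<Sum>i<Suc K. 2 ^ i :: real)"
      by (intro sum_mono) auto
    also have "\<dots> = 2 * 2 ^ K - 1" by (induction K) auto
    finally show ?thesis using True by linarith
  qed (use Suc in simp)
qed (use assms in simp)

text \<open>\<open>enn_powr\<close> passes through \<open>enn2real\<close>, which sends infinity to
  0, so the bound carries over to the supremum only once the supremum is known to be finite; a
  finite \<open>S\<close> gives that.\<close>

lemma enn_powr_half_SUP_le:
  assumes "\<And>i. i \<in> I \<Longrightarrow> a i \<ge> 0" "\<And>i. i \<in> I \<Longrightarrow> ennreal (sqrt (a i)) \<le> S"
  shows "enn_powr (SUP i\<in>I. ennreal (a i)) (1 / 2) \<le> S"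
proof (cases S rule: ennreal_cases)
  case (real r)
  have a: "a i \<le> r\<^sup>2" if "i \<in> I" for i
  proof -
    have "sqrt (a i) \<le> r" using assms(2)[OF that] real by (simp add: ennreal_le_iff)
    then show ?thesis by (rule sqrt_le_D)
  qed
  define s where "s = (SUP i\<in>I. ennreal (a i))"
  have s: "s \<le> ennreal (r\<^sup>2)" unfolding s_def by (intro SUP_least ennreal_leI a)
  then have "s \<noteq> \<infinity>" by (auto simp: top_unique)
  have "enn2real s \<le> r\<^sup>2"
    using enn2real_mono[OF s] by simp
  then have "enn2real s powr (1 / 2) \<le> (r\<^sup>2) powr (1 / 2)"
    by (intro powr_mono2) auto
  also have "\<dots> = r" using real by (simp add: powr_half_sqrt)
  finally show ?thesis
    using \<open>s \<noteq> \<infinity>\<close> real unfolding enn_powr_def s_def[symmetric] by (simp add: ennreal_leI)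
qed simp

section \<open>The generalized powers M_k\<close>

locale vilenkin =
  fixes m :: "nat \<Rightarrow> nat" and B :: nat
  assumes m_ge2: "m k \<ge> 2" and m_le: "m k \<le> B"
begin

abbreviation M :: "nat \<Rightarrow> nat" where "M \<equiv> vM m"

lemma M_0 [simp]: "M 0 = 1"
  by (simp add: vM_def)

lemma M_Suc: "M (Suc k) = m k * M k"
  by (simp add: vM_def)

lemma m_pos [simp]: "m k > 0"
  using m_ge2[of k] by linarith

lemma B_ge2: "B \<ge> 2"
  using m_ge2[of 0] m_le[of 0] by linarith

lemma M_pos [simp]: "M k > 0"
  by (simp add: vM_def)

lemma M_neq_0 [simp]: "M k \<noteq> 0"
  using M_pos[of k] by simp

lemma M_Suc_ge: "2 * M k \<le> M (Suc k)"
  using m_ge2[of k] by (simp add: M_Suc)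

lemma M_Suc_le: "M (Suc k) \<le> B * M k"
  using m_le[of k] by (simp add: M_Suc)

lemma M_add_ge: "2 ^ j * M k \<le> M (k + j)"
proof (induction j)
  case (Suc j)
  then show ?case using M_Suc_ge[of "k + j"] by simp
qed simp

lemma M_ge_power: "2 ^ j \<le> M j"
  using M_add_ge[of j 0] by simp

lemma M_mono: "k \<le> l \<Longrightarrow> M k \<le> M l"
proof (erule lift_Suc_mono_le[rotated])
  fix k show "M k \<le> M (Suc k)" using M_Suc_ge[of k] by linarith
qed

lemma sum_M_le: "(\<Sum>k<s. M k) \<le> M s"
proof (induction s)
  case (Suc s)
  then show ?case using M_Suc_ge[of s] by simp
qed simp

lemma exists_M_interval:
  assumes "n \<ge> 1"
  obtains A where "M A \<le> n" "n < M (Suc A)"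
proof -
  define L where "L = (LEAST L. n < M L)"
  have "n < M n"
    using M_ge_power[of n] less_exp[of n] by linarith
  then have L: "n < M L" unfolding L_def by (rule LeastI)
  then obtain A where A: "L = Suc A" using assms by (cases L) auto
  have "\<not> n < M A" using not_less_Least[of A "\<lambda>L. n < M L"] A L_def by simp
  with L A show ?thesis by (intro that[of A]) auto
qed

subsection \<open>The Fejer kernel\<close>

text \<open>The argument \<open>r\<close> is the sequence of values of the Rademacher functions at one point;
  below it is taken at \<open>x - t\<close>, where \<open>E k\<close> says that \<open>x k = t k\<close>.\<close>

definition psi :: "(nat \<Rightarrow> complex) \<Rightarrow> nat \<Rightarrow> complex" where
  "psi r n = (\<Prod>k\<in>{k. vdigit m n k \<noteq> 0}. r k ^ vdigit m n k)"

definition dirichlet :: "(nat \<Rightarrow> complex) \<Rightarrow> nat \<Rightarrow> complex" where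
  "dirichlet r n = (\<Sum>i<n. psi r i)"

text \<open>This is n K_n: the factor 1/n is left out because the unnormalised sums satisfy a clean
  recursion over blocks of length M_s.\<close>

definition fejer :: "(nat \<Rightarrow> complex) \<Rightarrow> nat \<Rightarrow> complex" where
  "fejer r n = (\<Sum>k<n. dirichlet r k)"

lemma vdigit_eq_0:
  assumes "n < M s" "s \<le> k"
  shows "vdigit m n k = 0"
  using assms M_mono[of s k] by (simp add: vdigit_def)

lemma psi_eq_prod:
  assumes "n < M s"
  shows "psi r n = (\<Prod>k<s. r k ^ vdigit m n k)"
  unfolding psi_def
proof (rule prod.mono_neutral_left)
  show "{k. vdigit m n k \<noteq> 0} \<subseteq> {..<s}"
  proof
    fix k assume "k \<in> {k. vdigit m n k \<noteq> 0}"
    then have "\<not> s \<le> k" using vdigit_eq_0[OF assms, of k] by auto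
    then show "k \<in> {..<s}" by simp
  qed
qed auto

lemma vdigit_mod:
  assumes "k < s"
  shows "vdigit m (n mod M s) k = vdigit m n k"
proof -
  obtain j where j: "s = Suc k + j" using assms less_iff_Suc_add by auto
  obtain R where R: "M s = M k * (m k * R)"
  proof -
    have "M (Suc k) dvd M (Suc k + j)"
      by (induction j) (auto simp: M_Suc)
    then show ?thesis using that j M_Suc[of k] by (auto simp: dvd_def mult_ac)
  qed
  have "n mod M s div M k = (n div M k) mod (m k * R)"
    unfolding R mod_mult2_eq[of n "M k" "m k * R"] by simp
  then show ?thesis
    unfolding vdigit_def by (simp only: mod_mod_cancel dvd_triv_left)
qed

lemma psi_split:
  assumes "n < M (Suc s)"
  shows "psi r n = r s ^ (n div M s) * psi r (n mod M s)"
proof -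
  have "n div M s < m s"
    using assms by (simp add: M_Suc less_mult_imp_div_less)
  then have "vdigit m n s = n div M s" by (simp add: vdigit_def)
  then show ?thesis
    using psi_eq_prod[OF assms, of r] psi_eq_prod[of "n mod M s" s r]
    by (simp add: vdigit_mod)
qed

lemma psi_block:
  assumes "e < m s" "i < M s"
  shows "psi r (e * M s + i) = r s ^ e * psi r i"
proof -
  have "e * M s + i < Suc e * M s" using assms by simp
  also have "\<dots> \<le> M (Suc s)" unfolding M_Suc using assms by (intro mult_le_mono1) simp
  finally show ?thesis using psi_split[of "e * M s + i" s r] assms by simp
qed

lemma norm_psi:
  assumes "\<And>k. norm (r k) = 1"
  shows "norm (psi r n) = 1"
  unfolding psi_def prod_norm[symmetric] norm_power assms by simp

text \<open>For i < M_s the indices e M_s + i and i differ only in the digit s, so psi picks up the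
  constant factor r_s^e and each block repeats the initial one.\<close>

lemma dirichlet_block:
  assumes "e < m s" "i \<le> M s"
  shows "dirichlet r (e * M s + i) = dirichlet r (e * M s) + r s ^ e * dirichlet r i"
  using assms(2)
proof (induction i)
  case (Suc i)
  then show ?case
    using psi_block[OF assms(1), of i r] by (simp add: dirichlet_def algebra_simps)
qed (simp add: dirichlet_def)

lemma dirichlet_mult_M:
  assumes "e \<le> m s"
  shows "dirichlet r (e * M s) = (\<Sum>d<e. r s ^ d) * dirichlet r (M s)"
  using assms
proof (induction e)
  case (Suc e)
  then show ?case
    using dirichlet_block[of e s "M s" r] by (simp add: algebra_simps)
qed (simp add: dirichlet_def)

lemma fejer_block:
  assumes "e < m s" "i \<le> M s"
  shows "fejer r (e * M s + i) = fejer r (e * M s) + of_nat i * dirichlet r (e * M s) + r s ^ e * fejer r i"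
  using assms(2)
proof (induction i)
  case (Suc i)
  then show ?case
    using dirichlet_block[OF assms(1), of i r] by (simp add: fejer_def algebra_simps)
qed (simp add: fejer_def)

text \<open>Each complete block contributes M_s copies of the Dirichlet kernel at its left end and a
  rotated copy of the kernel for M_s.\<close>

lemma fejer_mult_M:
  assumes "e \<le> m s"
  shows "fejer r (e * M s) =
    of_nat (M s) * (\<Sum>d<e. dirichlet r (d * M s)) + (\<Sum>d<e. r s ^ d) * fejer r (M s)"
  using assms
proof (induction e)
  case (Suc e)
  then show ?case
    using fejer_block[of e s "M s" r] by (simp add: algebra_simps)
qed (simp add: fejer_def)

context
  fixes r :: "nat \<Rightarrow> complex" and E :: "nat \<Rightarrow> bool"
  assumes norm_r: "\<And>k. norm (r k) = 1"
    and sum_r: "\<And>k. (\<Sum>d<m k. r k ^ d) = (if E k then of_nat (m k) else 0)"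
begin

text \<open>The recursion makes D_{M_s} the product over j < s of complete geometric sums, and
  \<open>sum_r\<close> evaluates each factor.\<close>

lemma dirichlet_M: "dirichlet r (M s) = (if \<forall>j<s. E j then of_nat (M s) else 0)"
proof (induction s)
  case 0
  have "psi r 0 = 1" by (simp add: psi_def vdigit_def)
  then show ?case by (simp add: dirichlet_def)
next
  case (Suc s)
  have "dirichlet r (M (Suc s)) = (\<Sum>d<m s. r s ^ d) * dirichlet r (M s)"
    unfolding M_Suc by (rule dirichlet_mult_M) simp
  then show ?case using Suc sum_r[of s] by (auto simp: M_Suc less_Suc_eq)
qed

lemma norm_geometric_le: "norm (\<Sum>d<e. r s ^ d) \<le> real e"
  using sum_norm_le[of "{..<e}" "\<lambda>d. r s ^ d" "\<lambda>_. 1"] by (simp add: norm_power norm_r)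

lemma norm_dirichlet_mult_M:
  assumes "e \<le> m s"
  shows "norm (dirichlet r (e * M s)) \<le> real B * norm (dirichlet r (M s))"
proof -
  have "real e \<le> real B" using assms m_le[of s] by simp
  then show ?thesis
    using norm_geometric_le[of s e]
    by (simp add: dirichlet_mult_M[OF assms] norm_mult mult_right_mono)
qed

lemma norm_sum_dirichlet:
  assumes "e \<le> m s"
  shows "norm (of_nat (M s) * (\<Sum>d<e. dirichlet r (d * M s))) \<le>
    real B ^ 2 * real (M s) * norm (dirichlet r (M s))"
proof -
  have "norm (\<Sum>d<e. dirichlet r (d * M s)) \<le> (\<Sum>d<e. real B * norm (dirichlet r (M s)))"
    using assms by (intro sum_norm_le norm_dirichlet_mult_M) auto
  also have "\<dots> = real e * (real B * norm (dirichlet r (M s)))" by simp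
  also have "\<dots> \<le> real B * (real B * norm (dirichlet r (M s)))"
    using assms m_le[of s] by (intro mult_right_mono) auto
  finally have "real (M s) * norm (\<Sum>d<e. dirichlet r (d * M s))
      \<le> real (M s) * (real B * (real B * norm (dirichlet r (M s))))"
    by (intro mult_left_mono) auto
  then show ?thesis by (simp add: norm_mult power2_eq_square mult_ac)
qed

lemma real_M_mult_norm_dirichlet:
  "real (M s) * norm (dirichlet r (M s)) = real (M s) ^ 2 * of_bool (\<forall>j<s. E j)"
  by (simp add: dirichlet_M power2_eq_square)

text \<open>Passing from s to s + 1 multiplies the kernel by a complete geometric sum in
  \<open>r s\<close>, which vanishes unless \<open>E s\<close>. The term for k is born at step k
  from the D_{d M_k}, which are supported where all coordinates below k match and are unconstrained
  at k; each later step adds one matching condition. Hence only coordinate k stays free.\<close>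

lemma norm_fejer_M:
  "norm (fejer r (M s)) \<le>
    real B ^ 2 * real (M s) * (\<Sum>k<s. real (M k) * of_bool (\<forall>i\<in>{..<s} - {k}. E i))"
proof (induction s)
  case 0
  then show ?case by (simp add: fejer_def dirichlet_def)
next
  case (Suc s)
  let ?S = "\<lambda>s. \<Sum>k<s. real (M k) * of_bool (\<forall>i\<in>{..<s} - {k}. E i)"
  have restrict: "(\<Sum>k<s. real (M k) * of_bool (\<forall>i\<in>{..<Suc s} - {k}. E i)) = of_bool (E s) * ?S s"
    unfolding sum_distrib_left
    by (intro sum.cong refl) (simp add: lessThan_Suc insert_Diff_if of_bool_conj mult_ac)
  have last: "(\<forall>i\<in>{..<Suc s} - {s}. E i) \<longleftrightarrow> (\<forall>j<s. E j)"
    by (auto simp: less_Suc_eq)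
  have eq: "fejer r (M (Suc s)) = of_nat (M s) * (\<Sum>d<m s. dirichlet r (d * M s))
      + (\<Sum>d<m s. r s ^ d) * fejer r (M s)"
    unfolding M_Suc by (rule fejer_mult_M) simp
  have "norm (fejer r (M (Suc s))) \<le> real B ^ 2 * real (M s) * norm (dirichlet r (M s))
      + norm (\<Sum>d<m s. r s ^ d) * norm (fejer r (M s))"
    unfolding eq norm_mult[of "sum _ _", symmetric]
    by (rule order_trans[OF norm_triangle_ineq add_right_mono[OF norm_sum_dirichlet[OF order.refl]]])
  also have "\<dots> \<le> real B ^ 2 * (real (M s) ^ 2 * of_bool (\<forall>j<s. E j))
      + (real (m s) * of_bool (E s)) * (real B ^ 2 * real (M s) * ?S s)"
  proof (rule add_mono)
    show "real B ^ 2 * real (M s) * norm (dirichlet r (M s)) \<le> real B ^ 2 * (real (M s) ^ 2 * of_bool (\<forall>j<s. E j))"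
      unfolding mult.assoc real_M_mult_norm_dirichlet ..
    show "norm (\<Sum>d<m s. r s ^ d) * norm (fejer r (M s)) \<le>
        real (m s) * of_bool (E s) * (real B ^ 2 * real (M s) * ?S s)"
      using Suc sum_r[of s] by (intro mult_mono) auto
  qed
  \<comment> \<open>One factor \<open>M s\<close> is enlarged so that the new term takes the shape
    of the summand k = s at step s + 1.\<close>
  also have "\<dots> \<le> real B ^ 2 * (real (M (Suc s)) * real (M s) * of_bool (\<forall>j<s. E j))
      + (real (m s) * of_bool (E s)) * (real B ^ 2 * real (M s) * ?S s)"
  proof (intro add_right_mono mult_left_mono mult_right_mono)
    show "real (M s) ^ 2 \<le> real (M (Suc s)) * real (M s)"
      unfolding power2_eq_square using M_mono[of s "Suc s"] by (intro mult_right_mono) auto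
  qed auto
  also have "\<dots> = real B ^ 2 * real (M (Suc s)) * ?S (Suc s)"
    using restrict last by (simp add: M_Suc algebra_simps)
  finally show ?case .
qed

text \<open>The induction removes the leading digit of n: \<open>fejer_block\<close> leaves complete
  blocks, i copies of D_{e M_s} and a rotated kernel for the remainder i. The first two cost one
  Dirichlet term each, whence the 2.\<close>

lemma norm_fejer_le_aux:
  assumes "n < M A"
  shows "norm (fejer r n) \<le> (\<Sum>s<A. 2 * real B ^ 2 * (real (M s) ^ 2 * of_bool (\<forall>j<s. E j))
    + real B * norm (fejer r (M s)))"
  using assms
proof (induction A arbitrary: n)
  case 0
  then show ?case by (simp add: fejer_def)
next
  case (Suc s)
  define e i where "e = n div M s" and "i = n mod M s"
  have n: "n = e * M s + i" unfolding e_def i_def by (rule div_mult_mod_eq[symmetric])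
  have e: "e < m s" using Suc.prems by (simp add: e_def M_Suc less_mult_imp_div_less)
  have i: "i < M s" by (simp add: i_def)
  let ?D = "norm (dirichlet r (M s))"
  have BB: "real B \<le> real B ^ 2" using B_ge2 by (simp add: power2_eq_square)
  have "real i * norm (dirichlet r (e * M s)) \<le> real (M s) * (real B * ?D)"
    using e i norm_dirichlet_mult_M[of e s] by (intro mult_mono) auto
  also have "\<dots> \<le> real B ^ 2 * (real (M s) * ?D)"
    using mult_right_mono[OF BB, of "real (M s) * ?D"] by (simp add: mult_ac)
  finally have 1: "norm (of_nat i * dirichlet r (e * M s)) \<le> real B ^ 2 * (real (M s) * ?D)"
    by (simp add: norm_mult)
  have "real e \<le> real B" using e m_le[of s] by simp
  then have "norm (\<Sum>d<e. r s ^ d) * norm (fejer r (M s)) \<le> real B * norm (fejer r (M s))"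
    using norm_geometric_le[of s e] by (intro mult_right_mono) auto
  then have 2: "norm (fejer r (e * M s)) \<le> real B ^ 2 * (real (M s) * ?D) + real B * norm (fejer r (M s))"
    using e norm_sum_dirichlet[of e s] unfolding fejer_mult_M[OF less_imp_le[OF e]]
    by (intro norm_triangle_mono) (auto simp: norm_mult mult_ac)
  have 3: "norm (r s ^ e * fejer r i) = norm (fejer r i)"
    by (simp add: norm_mult norm_power norm_r)
  have "norm (fejer r n) \<le> (real B ^ 2 * (real (M s) * ?D) + real B * norm (fejer r (M s)))
      + real B ^ 2 * (real (M s) * ?D) + norm (fejer r i)"
    unfolding n fejer_block[OF e less_imp_le[OF i]]
    using 1 2 3 by (intro norm_triangle_mono) auto
  then show ?case
    using Suc.IH[OF i] unfolding real_M_mult_norm_dirichlet by simp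
qed

text \<open>A Dirichlet term at s fits into the summand k = s of row s + 1, since omitting
  coordinate s from the first s + 1 leaves the first s. This shift is why the rows run up to s =
  A.\<close>

lemma norm_fejer_le:
  assumes "n < M A"
  shows "norm (fejer r n) \<le> 2 * real B ^ 3 *
    (\<Sum>s\<le>A. \<Sum>k<s. real (M s) * real (M k) * of_bool (\<forall>i\<in>{..<s} - {k}. E i))"
proof -
  let ?T = "\<lambda>s k. real (M s) * real (M k) * of_bool (\<forall>i\<in>{..<s} - {k}. E i)"
  define S where "S s = (\<Sum>k<s. ?T s k)" for s
  have nonneg: "S s \<ge> 0" for s unfolding S_def by (intro sum_nonneg) auto
  have diag: "real (M s) ^ 2 * of_bool (\<forall>j<s. E j) \<le> S (Suc s)" for s
  proof -
    have "(\<forall>i\<in>{..<Suc s} - {s}. E i) \<longleftrightarrow> (\<forall>j<s. E j)"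
      by (auto simp: less_Suc_eq)
    then have "real (M s) ^ 2 * of_bool (\<forall>j<s. E j) \<le> ?T (Suc s) s"
      using M_Suc_ge[of s] by (auto simp: power2_eq_square)
    also have "\<dots> \<le> S (Suc s)" unfolding S_def by (rule member_le_sum) auto
    finally show ?thesis .
  qed
  have full: "norm (fejer r (M s)) \<le> real B ^ 2 * S s" for s
  proof -
    have "S s = real (M s) * (\<Sum>k<s. real (M k) * of_bool (\<forall>i\<in>{..<s} - {k}. E i))"
      unfolding S_def sum_distrib_left mult.assoc ..
    then show ?thesis using norm_fejer_M[of s] unfolding mult.assoc by simp
  qed
  have "norm (fejer r n) \<le> (\<Sum>s<A. 2 * real B ^ 2 * S (Suc s) + real B * (real B ^ 2 * S s))"
    using diag full by (intro order_trans[OF norm_fejer_le_aux[OF assms]] sum_mono add_mono mult_left_mono) auto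
  also have "\<dots> = 2 * real B ^ 2 * (\<Sum>s<A. S (Suc s)) + real B ^ 3 * (\<Sum>s<A. S s)"
    by (simp add: sum.distrib sum_distrib_left power3_eq_cube power2_eq_square mult_ac)
  also have "\<dots> \<le> real B ^ 3 * (\<Sum>s\<le>A. S s) + real B ^ 3 * (\<Sum>s\<le>A. S s)"
  proof (intro add_mono mult_mono mult_left_mono)
    show "2 * (real B)\<^sup>2 \<le> real B ^ 3"
      using B_ge2 by (simp add: power3_eq_cube power2_eq_square)
    have "(\<Sum>s<A. S (Suc s)) = (\<Sum>s\<in>{1..A}. S s)"
      by (rule sum.reindex_bij_witness[of _ "\<lambda>s. s - 1" Suc]) auto
    also have "\<dots> \<le> (\<Sum>s\<le>A. S s)"
      using nonneg by (intro sum_mono2) auto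
    finally show "(\<Sum>s<A. S (Suc s)) \<le> (\<Sum>s\<le>A. S s)" .
    show "(\<Sum>s<A. S s) \<le> (\<Sum>s\<le>A. S s)"
      using nonneg by (intro sum_mono2) auto
  qed (use nonneg in \<open>auto intro: sum_nonneg\<close>)
  finally show ?thesis by (simp add: S_def)
qed

end

subsection \<open>Functions of finitely many coordinates\<close>

abbreviation G :: "(nat \<Rightarrow> nat) measure" where "G \<equiv> vG m"

lemma prob_space_factor: "prob_space (uniform_count_measure {..<m k})"
  by (rule prob_space_uniform_count_measure) (auto simp: lessThan_empty_iff)

lemma product_prob_space_factors: "product_prob_space (\<lambda>k. uniform_count_measure {..<m k})"
proof -
  interpret prob_space "uniform_count_measure {..<m k}" for k
    by (rule prob_space_factor)
  show ?thesis by unfold_locales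
qed

lemma space_G: "space G = {x. \<forall>k. x k < m k}"
  by (auto simp: vG_def space_PiM space_uniform_count_measure PiE_def Pi_def)

lemma prob_space_G: "prob_space G"
proof -
  interpret product_prob_space "\<lambda>k. uniform_count_measure {..<m k}" UNIV
    by (rule product_prob_space_factors)
  show ?thesis unfolding vG_def by unfold_locales
qed

text \<open>The kernel bound fixes all of the first s coordinates but one, so the cells
  \<open>vI\<close> do not suffice and \<open>J\<close> is left arbitrary.\<close>

definition cylinder :: "nat set \<Rightarrow> (nat \<Rightarrow> nat) \<Rightarrow> (nat \<Rightarrow> nat) set" where
  "cylinder J x = {t \<in> space G. \<forall>i\<in>J. t i = x i}"

lemma vI_eq_cylinder: "vI m n x = cylinder {..<n} x"
  by (auto simp: vI_def cylinder_def)

lemma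
  assumes "finite J" "x \<in> space G"
  shows cylinder_sets: "cylinder J x \<in> sets G"
    and measure_cylinder: "measure G (cylinder J x) = (\<Prod>i\<in>J. 1 / real (m i))"
proof -
  have x: "x i < m i" for i using assms by (simp add: space_G)
  have eq: "cylinder J x = {t \<in> space G. \<forall>i\<in>J. t i \<in> {x i}}" by (simp add: cylinder_def)
  show "cylinder J x \<in> sets G"
    unfolding eq vG_def using assms(1) x
    by (intro sets.sets_Collect_finite_All sets_Collect_single') 
       (auto simp: sets_uniform_count_measure space_uniform_count_measure)
  have "emeasure G (cylinder J x) = (\<Prod>i\<in>J. emeasure (uniform_count_measure {..<m i}) {x i})"
    unfolding eq vG_def using assms(1) x
    by (intro product_prob_space.emeasure_PiM_Collect product_prob_space_factors) (auto simp: sets_uniform_count_measure)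
  also have "\<dots> = (\<Prod>i\<in>J. ennreal (1 / real (m i)))"
    using x by (intro prod.cong refl) (simp add: emeasure_uniform_count_measure)
  also have "\<dots> = ennreal (\<Prod>i\<in>J. 1 / real (m i))"
    by (rule prod_ennreal) simp
  finally show "measure G (cylinder J x) = (\<Prod>i\<in>J. 1 / real (m i))"
    by (simp add: measure_def prod_nonneg)
qed

lemma vI_sets [simp]: "x \<in> space G \<Longrightarrow> vI m n x \<in> sets G"
  unfolding vI_eq_cylinder by (rule cylinder_sets) auto

lemma measure_vI: "x \<in> space G \<Longrightarrow> measure G (vI m n x) = 1 / real (M n)"
  unfolding vI_eq_cylinder by (subst measure_cylinder) (auto simp: vM_def prod_dividef)

lemma emeasure_G: "emeasure G A = ennreal (measure G A)"
  using prob_space_G by (simp add: finite_measure.emeasure_eq_measure prob_space_def)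

text \<open>A pointwise substitute for F_n-measurability. It passes through arbitrary compositions,
  and since such a function has finitely many values on G, its measurability, boundedness and
  integrability are automatic.\<close>

definition depends :: "nat \<Rightarrow> ((nat \<Rightarrow> nat) \<Rightarrow> 'b) \<Rightarrow> bool" where
  "depends n g \<longleftrightarrow> (\<forall>x\<in>space G. \<forall>y\<in>space G. (\<forall>i<n. x i = y i) \<longrightarrow> g x = g y)"

lemma dependsI:
  "(\<And>x y. x \<in> space G \<Longrightarrow> y \<in> space G \<Longrightarrow> (\<And>i. i < n \<Longrightarrow> x i = y i) \<Longrightarrow> g x = g y) \<Longrightarrow> depends n g"
  unfolding depends_def by blast

lemma dependsD:
  "depends n g \<Longrightarrow> x \<in> space G \<Longrightarrow> y \<in> space G \<Longrightarrow> (\<And>i. i < n \<Longrightarrow> x i = y i) \<Longrightarrow> g x = g y"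
  unfolding depends_def by blast

lemma depends_mono:
  assumes "depends n g" "n \<le> k"
  shows "depends k g"
proof (rule dependsI)
  fix x y assume "x \<in> space G" "y \<in> space G" "\<And>i. i < k \<Longrightarrow> x i = y i"
  then show "g x = g y" using assms(2) by (intro dependsD[OF assms(1)]) auto
qed

lemma depends_const: "depends n (\<lambda>x. c)"
  by (simp add: depends_def)

lemma depends_comp2:
  assumes "depends n g" "depends n g'"
  shows "depends n (\<lambda>x. h (g x) (g' x))"
proof (rule dependsI)
  fix x y assume xy: "x \<in> space G" "y \<in> space G" "\<And>i. i < n \<Longrightarrow> x i = y i"
  show "h (g x) (g' x) = h (g y) (g' y)"
    by (simp only: dependsD[OF assms(1) xy] dependsD[OF assms(2) xy])
qed

lemma depends_comp:
  assumes "depends n g"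
  shows "depends n (\<lambda>x. h (g x))"
  using depends_comp2[OF assms assms, of "\<lambda>a _. h a"] .

lemma depends_sum:
  assumes "\<And>i. i \<in> I \<Longrightarrow> depends n (\<lambda>x. g i x)"
  shows "depends n (\<lambda>x. \<Sum>i\<in>I. g i x)"
proof (rule dependsI)
  fix x y assume xy: "x \<in> space G" "y \<in> space G" "\<And>i. i < n \<Longrightarrow> x i = y i"
  show "(\<Sum>i\<in>I. g i x) = (\<Sum>i\<in>I. g i y)"
    by (rule sum.cong[OF refl]) (rule dependsD[OF assms xy])
qed

lemma depends_vI: "depends n (\<lambda>x. x \<in> vI m n u)"
  by (rule dependsI) (simp add: vI_def)

definition trunc :: "nat \<Rightarrow> (nat \<Rightarrow> nat) \<Rightarrow> nat \<Rightarrow> nat" where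
  "trunc n x = (\<lambda>i. if i < n then x i else 0)"

text \<open>One point in each cell of level n, which turns decompositions over cells into finite
  sums.\<close>

definition reps :: "nat \<Rightarrow> (nat \<Rightarrow> nat) set" where
  "reps n = trunc n ` space G"

lemma trunc_space: "x \<in> space G \<Longrightarrow> trunc n x \<in> space G"
  by (simp add: space_G trunc_def)

lemma reps_space: "u \<in> reps n \<Longrightarrow> u \<in> space G"
  by (auto simp: reps_def trunc_space)

lemma trunc_in_reps: "x \<in> space G \<Longrightarrow> trunc n x \<in> reps n"
  by (simp add: reps_def)

lemma finite_reps [simp]: "finite (reps n)"
proof (rule finite_subset)
  show "reps n \<subseteq> {u. \<forall>i. (i \<in> {..<n} \<longrightarrow> u i \<in> {..<B}) \<and> (i \<notin> {..<n} \<longrightarrow> u i = 0)}"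
  proof
    fix u assume "u \<in> reps n"
    then obtain x where x: "x \<in> space G" "u = trunc n x" by (auto simp: reps_def)
    have "x i < B" for i using x(1) m_le[of i] less_le_trans[of "x i" "m i" B] by (simp add: space_G)
    then show "u \<in> {u. \<forall>i. (i \<in> {..<n} \<longrightarrow> u i \<in> {..<B}) \<and> (i \<notin> {..<n} \<longrightarrow> u i = 0)}"
      by (simp add: x trunc_def)
  qed
  show "finite \<dots>" by (rule finite_set_of_finite_funs) auto
qed

lemma mem_vI_reps_iff:
  assumes "x \<in> space G" "u \<in> reps n"
  shows "x \<in> vI m n u \<longleftrightarrow> u = trunc n x"
proof
  assume x: "x \<in> vI m n u"
  from assms(2) obtain y where "u = trunc n y" by (auto simp: reps_def)
  with x show "u = trunc n x" by (auto simp: vI_def trunc_def)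
next
  assume "u = trunc n x" then show "x \<in> vI m n u" using assms by (simp add: vI_def trunc_def)
qed

lemma depends_trunc: "depends n g \<Longrightarrow> x \<in> space G \<Longrightarrow> g (trunc n x) = g x"
  by (rule dependsD[of n g]) (simp_all only: trunc_space, simp add: trunc_def)

lemma sum_reps:
  fixes h :: "(nat \<Rightarrow> nat) \<Rightarrow> 'b::comm_monoid_add"
  assumes "x \<in> space G"
  shows "(\<Sum>u\<in>reps n. if x \<in> vI m n u then h u else 0) = h (trunc n x)"
proof -
  have "(\<Sum>u\<in>reps n. if x \<in> vI m n u then h u else 0) = (\<Sum>u\<in>reps n. if u = trunc n x then h u else 0)"
    using assms by (intro sum.cong refl) (simp add: mem_vI_reps_iff)
  also have "\<dots> = h (trunc n x)"
    using trunc_in_reps[OF assms] by simp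
  finally show ?thesis .
qed

lemma depends_borel:
  fixes g :: "(nat \<Rightarrow> nat) \<Rightarrow> 'b::topological_space"
  assumes "depends n g"
  shows "g \<in> borel_measurable G"
proof (rule measurableI)
  fix A :: "'b set"
  have "g -` A \<inter> space G = (\<Union>u\<in>{u\<in>reps n. g u \<in> A}. vI m n u)" (is "?L = ?R")
  proof
    show "?L \<subseteq> ?R"
    proof
      fix x assume x: "x \<in> ?L"
      then have "trunc n x \<in> reps n" by (simp add: reps_def)
      with x show "x \<in> ?R"
        using depends_trunc[OF assms, of x] mem_vI_reps_iff[of x "trunc n x" n] by auto
    qed
    show "?R \<subseteq> ?L"
    proof
      fix x assume "x \<in> ?R"
      then obtain u where u: "u \<in> reps n" "g u \<in> A" "x \<in> vI m n u" by blast
      then have x: "x \<in> space G" by (simp add: vI_def)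
      with u have "u = trunc n x" by (simp add: mem_vI_reps_iff)
      with u x show "x \<in> ?L" using depends_trunc[OF assms, of x] by simp
    qed
  qed
  then show "g -` A \<inter> space G \<in> sets G"
    by (auto intro!: sets.finite_UN simp: reps_space)
qed simp

lemma depends_sets: "depends n P \<Longrightarrow> {x \<in> space G. P x} \<in> sets G"
  using depends_borel[of n "\<lambda>x. of_bool (P x) :: real"] depends_comp[of n P "of_bool :: _ \<Rightarrow> real"]
    borel_measurable_vimage[of "\<lambda>x. of_bool (P x) :: real" G 1]
  by (simp add: vimage_def Int_def conj_commute)

lemma depends_bounded:
  fixes g :: "(nat \<Rightarrow> nat) \<Rightarrow> 'b::real_normed_vector"
  assumes "depends n g"
  obtains C where "\<And>x. x \<in> space G \<Longrightarrow> norm (g x) \<le> C"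
proof
  fix x assume x: "x \<in> space G"
  show "norm (g x) \<le> Max ((\<lambda>u. norm (g u)) ` reps n)"
    using depends_trunc[OF assms x]
    by (intro Max_ge) (auto intro!: image_eqI[of _ _ "trunc n x"] trunc_in_reps[OF x])
qed

lemma depends_integrable:
  fixes g :: "(nat \<Rightarrow> nat) \<Rightarrow> 'b::{second_countable_topology,banach}"
  assumes "depends n g"
  shows "integrable G g"
proof -
  interpret P: prob_space G by (rule prob_space_G)
  obtain C where "\<And>x. x \<in> space G \<Longrightarrow> norm (g x) \<le> C"
    using depends_bounded[OF assms] by blast
  then show ?thesis
    by (intro P.integrable_const_bound[where B = C] AE_I2 depends_borel[OF assms])
qed

lemma norm_integral_le:
  fixes h :: "(nat \<Rightarrow> nat) \<Rightarrow> complex"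
  assumes "\<And>x. x \<in> space G \<Longrightarrow> norm (h x) \<le> C" "integrable G h"
  shows "norm (\<integral>x. h x \<partial>G) \<le> C"
proof -
  interpret P: prob_space G by (rule prob_space_G)
  have "norm (\<integral>x. h x \<partial>G) \<le> (\<integral>x. norm (h x) \<partial>G)" by (rule integral_norm_bound)
  also have "\<dots> \<le> (\<integral>x. C \<partial>G)"
    using assms by (intro integral_mono) auto
  finally show ?thesis by (simp add: P.prob_space)
qed

subsection \<open>Martingales\<close>

lemma vI_in_vF: "x \<in> space G \<Longrightarrow> vI m n x \<in> sets (vF m n)"
  unfolding vF_def by (subst sets_measure_of) (auto simp: vI_def)

lemma vF_saturated:
  assumes "A \<in> sets (vF m n)" "x \<in> space G" "y \<in> space G" "\<And>i. i < n \<Longrightarrow> x i = y i"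
  shows "x \<in> A \<longleftrightarrow> y \<in> A"
proof -
  have "A \<in> sigma_sets (space G) {vI m n x | x. x \<in> space G}"
    using assms(1) unfolding vF_def by (subst (asm) sets_measure_of) (auto simp: vI_def)
  then show ?thesis
  proof induction
    case (Basic A)
    then show ?case using assms(2-4) by (auto simp: vI_def)
  qed (use assms in auto)
qed

text \<open>The set where g takes the value g x lies in F_n, and no set of F_n separates points with
  the same first n coordinates.\<close>

lemma measurable_vF_depends:
  fixes g :: "(nat \<Rightarrow> nat) \<Rightarrow> complex"
  assumes "g \<in> borel_measurable (vF m n)"
  shows "depends n g"
proof (rule dependsI)
  fix x y assume xy: "x \<in> space G" "y \<in> space G" "\<And>i. i < n \<Longrightarrow> x i = y i"
  have sp: "space (vF m n) = space G" by (simp add: vF_def space_measure_of_conv)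
  have "g -` {g x} \<inter> space G \<in> sets (vF m n)"
    using measurable_sets[OF assms, of "{g x}"] sp by simp
  from vF_saturated[OF this xy] xy show "g x = g y" by auto
qed

lemma vmartingale_depends: "vmartingale m f \<Longrightarrow> depends n (f n)"
  unfolding vmartingale_def by (blast intro: measurable_vF_depends)

text \<open>g is constant on each cell of level n, so the integral reduces to set integrals over
  cells, the form in which the martingale property is given.\<close>

lemma integral_reps:
  fixes h g :: "(nat \<Rightarrow> nat) \<Rightarrow> complex"
  assumes "integrable G h" "depends n g"
  shows "(\<integral>x. h x * g x \<partial>G) = (\<Sum>u\<in>reps n. (LINT x:vI m n u|G. h x) * g u)"
proof -
  have "(\<integral>x. h x * g x \<partial>G) = (\<integral>x. (\<Sum>u\<in>reps n. (indicator (vI m n u) x *\<^sub>R h x) * g u) \<partial>G)"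
  proof (rule Bochner_Integration.integral_cong[OF refl])
    fix x assume x: "x \<in> space G"
    have "(\<Sum>u\<in>reps n. (indicator (vI m n u) x *\<^sub>R h x) * g u)
        = (\<Sum>u\<in>reps n. if x \<in> vI m n u then h x * g u else 0)"
      by (intro sum.cong refl) (auto simp: indicator_def)
    also have "\<dots> = h x * g (trunc n x)" by (rule sum_reps[OF x])
    finally show "h x * g x = (\<Sum>u\<in>reps n. (indicator (vI m n u) x *\<^sub>R h x) * g u)"
      using depends_trunc[OF assms(2) x] by simp
  qed
  also have "\<dots> = (\<Sum>u\<in>reps n. \<integral>x. (indicator (vI m n u) x *\<^sub>R h x) * g u \<partial>G)"
    using assms(1) by (intro Bochner_Integration.integral_sum integrable_mult_left integrable_mult_indicator)
      (auto simp: reps_space)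
  also have "\<dots> = (\<Sum>u\<in>reps n. (LINT x:vI m n u|G. h x) * g u)"
    unfolding set_lebesgue_integral_def by (simp only: integral_mult_left_zero)
  finally show ?thesis .
qed

lemma martingale_integral_Suc:
  fixes g :: "(nat \<Rightarrow> nat) \<Rightarrow> complex"
  assumes f: "vmartingale m f" and g: "depends n g"
  shows "(\<integral>x. f (Suc n) x * g x \<partial>G) = (\<integral>x. f n x * g x \<partial>G)"
proof -
  have int: "integrable G (f k)" for k using f by (simp add: vmartingale_def)
  show ?thesis
    unfolding integral_reps[OF int g] using f
    by (intro sum.cong refl arg_cong2[where f = "(*)"]) (auto simp: vmartingale_def vI_in_vF reps_space)
qed

lemma martingale_integral:
  fixes g :: "(nat \<Rightarrow> nat) \<Rightarrow> complex"
  assumes f: "vmartingale m f" and g: "depends n g" and "n \<le> k"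
  shows "(\<integral>x. f k x * g x \<partial>G) = (\<integral>x. f n x * g x \<partial>G)"
  using \<open>n \<le> k\<close>
proof (induction k rule: dec_induct)
  case (step k)
  then show ?case using martingale_integral_Suc[OF f depends_mono[OF g]] by simp
qed simp

subsection \<open>The kernel representation of Fejer means\<close>

text \<open>Since r_k is a character, this is r_k(x - t); subtraction in the group never has to be
  defined.\<close>

definition rho :: "(nat \<Rightarrow> nat) \<Rightarrow> (nat \<Rightarrow> nat) \<Rightarrow> nat \<Rightarrow> complex" where
  "rho x t k = vr m k x * cnj (vr m k t)"

lemma norm_vr: "norm (vr m k x) = 1"
proof -
  have "vr m k x = exp (\<i> * of_real (2 * pi * real (x k) / real (m k)))"
    by (simp add: vr_def mult_ac)
  then show ?thesis by (simp only: norm_exp_i_times)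
qed

lemma vr_power: "vr m k x ^ m k = 1"
proof -
  have "vr m k x ^ m k = exp (of_nat (m k) * (2 * of_real pi * \<i> * of_nat (x k) / of_nat (m k)))"
    unfolding vr_def by (rule exp_of_nat_mult[symmetric])
  also have "of_nat (m k) * (2 * of_real pi * \<i> * of_nat (x k) / of_nat (m k)) = (2 * of_real pi * \<i> * of_nat (x k) / of_nat 1 :: complex)"
    by simp
  also have "exp \<dots> = 1"
    using complex_root_unity_eq_1[of 1 "x k"] by simp
  finally show ?thesis .
qed

lemma vr_eq_iff:
  assumes "x \<in> space G" "t \<in> space G"
  shows "vr m k x = vr m k t \<longleftrightarrow> x k = t k"
  using complex_root_unity_eq[of "m k" "x k" "t k"] m_ge2[of k] assms
  by (simp add: vr_def space_G)

lemma norm_rho: "norm (rho x t k) = 1"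
  by (simp add: rho_def norm_mult norm_vr)

lemma rho_eq_1_iff:
  assumes "x \<in> space G" "t \<in> space G"
  shows "rho x t k = 1 \<longleftrightarrow> x k = t k"
proof -
  have 1: "vr m k t * cnj (vr m k t) = 1"
    by (simp add: complex_norm_square[symmetric] norm_vr)
  have 2: "rho x t k * vr m k t = vr m k x * (vr m k t * cnj (vr m k t))"
    unfolding rho_def by (simp only: mult_ac)
  have "rho x t k = 1 \<longleftrightarrow> vr m k x = vr m k t"
  proof
    assume "rho x t k = 1"
    then show "vr m k x = vr m k t" using 2 unfolding 1 by simp
  next
    assume "vr m k x = vr m k t"
    then show "rho x t k = 1" using 1 unfolding rho_def by simp
  qed
  then show ?thesis using vr_eq_iff[OF assms] by simp
qed

text \<open>A complete geometric sum over an m_k-th root of unity. It discharges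
  \<open>sum_r\<close>, with \<open>E k\<close> read as x k = t k.\<close>

lemma sum_rho:
  assumes "x \<in> space G" "t \<in> space G"
  shows "(\<Sum>d<m k. rho x t k ^ d) = (if x k = t k then of_nat (m k) else 0)"
proof (cases "x k = t k")
  case True
  then have "rho x t k = 1" using rho_eq_1_iff[OF assms] by simp
  then show ?thesis using True by simp
next
  case False
  then have "rho x t k \<noteq> 1" using rho_eq_1_iff[OF assms] by simp
  moreover have "rho x t k ^ m k = 1"
    unfolding rho_def power_mult_distrib complex_cnj_power[symmetric] vr_power by simp
  ultimately show ?thesis using False by (simp add: sum_gp_strict)
qed

lemma vpsi_eq_psi: "vpsi m i x = psi (\<lambda>k. vr m k x) i"
  by (simp add: vpsi_def psi_def)

lemma psi_rho: "psi (rho x t) i = vpsi m i x * cnj (vpsi m i t)"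
  by (simp add: psi_def vpsi_def rho_def power_mult_distrib prod.distrib)

lemma depends_vpsi:
  assumes "i < M L"
  shows "depends L (vpsi m i)"
proof (rule dependsI)
  fix x y :: "nat \<Rightarrow> nat" assume "\<And>i. i < L \<Longrightarrow> x i = y i"
  then show "vpsi m i x = vpsi m i y"
    unfolding vpsi_eq_psi psi_eq_prod[OF assms] by (intro prod.cong refl) (simp add: vr_def)
qed

lemma depends_fejer_rho:
  assumes "n \<le> M L"
  shows "depends L (\<lambda>t. fejer (rho x t) n)"
  unfolding fejer_def dirichlet_def psi_rho
proof (intro depends_sum)
  fix k i assume "k \<in> {..<n}" "i \<in> {..<k}"
  then have "i < M L" using assms by simp
  then show "depends L (\<lambda>t. vpsi m i x * cnj (vpsi m i t))"
    by (rule depends_comp[OF depends_vpsi])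
qed

text \<open>sigma_n as convolution with K_n, for arbitrary functions F: it will be applied to atoms,
  which are pieces of the single function f L.\<close>

definition fmean :: "((nat \<Rightarrow> nat) \<Rightarrow> complex) \<Rightarrow> nat \<Rightarrow> (nat \<Rightarrow> nat) \<Rightarrow> complex" where
  "fmean F n x = (\<integral>t. F t * fejer (rho x t) n \<partial>G) / of_nat n"

text \<open>psi_i depends on the first L coordinates only, so the sequence defining the coefficient
  is constant from k = L on.\<close>

lemma vfourier_eq:
  assumes "vmartingale m f" "i < M L"
  shows "vfourier m f i = (\<integral>x. f L x * cnj (vpsi m i x) \<partial>G)"
  unfolding vfourier_def
proof (rule limI, rule tendsto_eventually)
  show "\<forall>\<^sub>F k in sequentially. (\<integral>x. f k x * cnj (vpsi m i x) \<partial>G) = (\<integral>x. f L x * cnj (vpsi m i x) \<partial>G)"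
    using eventually_ge_at_top[of L]
  proof eventually_elim
    case (elim k)
    show ?case
      by (rule martingale_integral[OF assms(1) depends_comp[OF depends_vpsi[OF assms(2)]] elim])
  qed
qed

lemma vsigma_eq_fmean:
  assumes f: "vmartingale m f" and n: "n \<le> M L"
  shows "vsigma m f n x = fmean (f L) n x"
proof -
  have int: "integrable G (\<lambda>t. f L t * psi (rho x t) i)" if "i < M L" for i
    unfolding psi_rho
    by (rule depends_integrable[OF depends_comp2[OF vmartingale_depends[OF f] depends_vpsi[OF that]]])
  have coeff: "vfourier m f i * vpsi m i x = (\<integral>t. f L t * psi (rho x t) i \<partial>G)" if "i < M L" for i
  proof -
    have "(\<integral>t. f L t * psi (rho x t) i \<partial>G) = (\<integral>t. f L t * cnj (vpsi m i t) * vpsi m i x \<partial>G)"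
      by (simp only: psi_rho mult_ac)
    then show ?thesis unfolding vfourier_eq[OF f that] by (simp only: integral_mult_left_zero)
  qed
  have "(\<Sum>k<n. vS m f k x) = (\<Sum>k<n. \<Sum>i<k. \<integral>t. f L t * psi (rho x t) i \<partial>G)"
    unfolding vS_def using n by (intro sum.cong refl coeff) auto
  also have "\<dots> = (\<Sum>k<n. \<integral>t. (\<Sum>i<k. f L t * psi (rho x t) i) \<partial>G)"
    using n by (intro sum.cong refl Bochner_Integration.integral_sum[symmetric] int) auto
  also have "\<dots> = (\<integral>t. (\<Sum>k<n. \<Sum>i<k. f L t * psi (rho x t) i) \<partial>G)"
    using n by (intro Bochner_Integration.integral_sum[symmetric] Bochner_Integration.integrable_sum int) auto
  also have "\<dots> = (\<integral>t. f L t * fejer (rho x t) n \<partial>G)"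
    by (simp only: fejer_def dirichlet_def sum_distrib_left)
  finally show ?thesis by (simp add: vsigma_def fmean_def)
qed

lemma fmean_sum:
  assumes "\<And>i. i \<in> I \<Longrightarrow> depends L (F i)" "n \<le> M L"
  shows "fmean (\<lambda>t. \<Sum>i\<in>I. F i t) n x = (\<Sum>i\<in>I. fmean (F i) n x)"
proof -
  have "integrable G (\<lambda>t. F i t * fejer (rho x t) n)" if "i \<in> I" for i
    by (rule depends_integrable[OF depends_comp2[OF assms(1)[OF that] depends_fejer_rho[OF assms(2)]]])
  then show ?thesis
    unfolding fmean_def sum_distrib_right
    by (subst Bochner_Integration.integral_sum) (auto simp: sum_divide_distrib)
qed

lemma fmean_add:
  assumes "depends L F" "depends L F'" "n \<le> M L"
  shows "fmean (\<lambda>t. F t + F' t) n x = fmean F n x + fmean F' n x"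
  using fmean_sum[of UNIV L "\<lambda>b. if b then F else F'" n x] assms
  by (simp add: UNIV_bool add.commute)

text \<open>The crude bound |n K_n| <= n^2 loses a factor n. This is affordable because C will be
  the arbitrarily small bottom level \<open>e\<close>.\<close>

lemma norm_fmean_le:
  assumes F: "depends L F" "n \<le> M L" and le: "\<And>t. t \<in> space G \<Longrightarrow> norm (F t) \<le> C"
    and x: "x \<in> space G"
  shows "norm (fmean F n x) \<le> C * real n"
proof -
  have "0 \<le> C" using le[OF x] norm_ge_zero order_trans by blast
  have D: "norm (dirichlet r k) \<le> real k" if "\<And>k. norm (r k) = 1" for r k
    unfolding dirichlet_def using sum_norm_le[of "{..<k}" "psi r" "\<lambda>_. 1"] by (simp add: norm_psi[OF that])
  have D': "norm (fejer r n) \<le> real n * real n" if r: "\<And>k. norm (r k) = 1" for r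
  proof -
    have "norm (fejer r n) \<le> (\<Sum>k<n. real n)"
      unfolding fejer_def
    proof (rule sum_norm_le)
      fix k assume "k \<in> {..<n}"
      then show "norm (dirichlet r k) \<le> real n" using D[of r k, OF r] by simp
    qed
    then show ?thesis by simp
  qed
  have "norm (F t * fejer (rho x t) n) \<le> C * (real n * real n)" if "t \<in> space G" for t
    unfolding norm_mult using le[OF that] \<open>0 \<le> C\<close> D'[of "rho x t", OF norm_rho]
    by (intro mult_mono) auto
  then have "norm (\<integral>t. F t * fejer (rho x t) n \<partial>G) \<le> C * (real n * real n)"
    by (rule norm_integral_le) (assumption, rule depends_integrable[OF depends_comp2[OF F(1) depends_fejer_rho[OF F(2)]]])
  then have "norm (fmean F n x) \<le> C * (real n * real n) / real n"
    unfolding fmean_def norm_divide norm_of_nat by (intro divide_right_mono) auto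
  then show ?thesis using \<open>0 \<le> C\<close> by (simp split: if_splits)
qed

subsection \<open>Fejer means of atoms\<close>

lemma vI_Int_cylinder_subset: "vI m N u \<inter> cylinder J x \<noteq> {} \<Longrightarrow> x \<in> space G \<Longrightarrow> x \<in> cylinder (J \<inter> {..<N}) u"
  by (auto simp: vI_def cylinder_def)

lemma vI_Int_cylinder_eq:
  assumes "y \<in> vI m N u" "y \<in> cylinder J x"
  shows "vI m N u \<inter> cylinder J x = cylinder ({..<N} \<union> J) y"
  using assms by (auto simp: vI_def cylinder_def)

lemma prod_inverse_m: "(\<Prod>i<s. 1 / real (m i)) = 1 / real (M s)"
  by (simp add: vM_def prod_dividef)

lemma prod_inverse_m_remove:
  assumes "k < s"
  shows "(\<Prod>i\<in>{..<s} - {k}. 1 / real (m i)) = real (m k) / real (M s)"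
  using prod.remove[of "{..<s}" k "\<lambda>i. 1 / real (m i)"] assms m_pos[of k] prod_inverse_m[of s]
  by (simp add: field_simps)

lemma measure_cylinder_remove:
  assumes "k < s" "u \<in> space G"
  shows "measure G (cylinder ({..<s} - {k}) u) = real (m k) / real (M s)"
  using assms by (simp add: measure_cylinder prod_inverse_m_remove)

abbreviation hit :: "(nat \<Rightarrow> nat) \<Rightarrow> (nat \<Rightarrow> nat) \<Rightarrow> nat \<Rightarrow> nat \<Rightarrow> real" where
  "hit u x s k \<equiv> of_bool (x \<in> cylinder ({..<s} - {k}) u)"

text \<open>If the two sets meet, their intersection is a cylinder over the union of the index sets,
  and x agrees with u on the common coordinates. The cases differ in whether the cell pins the free
  coordinate k; for k >= N it does not, which costs the factor m_k <= B.\<close>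

lemma
  fixes x u :: "nat \<Rightarrow> nat" and k s N :: nat
  assumes x: "x \<in> space G" and u: "u \<in> space G" and k: "k < s"
  defines "W \<equiv> measure G (vI m N u \<inter> cylinder ({..<s} - {k}) x)"
  shows overlap_small: "s \<le> N \<Longrightarrow> W \<le> hit u x s k / real (M N)"
    and overlap_mid: "k < N \<Longrightarrow> N < s \<Longrightarrow> W \<le> hit u x N k / real (M s)"
    and overlap_large: "N \<le> k \<Longrightarrow> W \<le> of_bool (x \<in> vI m N u) * real B / real (M s)"
proof -
  have W_cases: "W \<le> of_bool (x \<in> cylinder (({..<s} - {k}) \<inter> {..<N}) u) * (\<Prod>i\<in>{..<N} \<union> ({..<s} - {k}). 1 / real (m i))"
  proof (cases "vI m N u \<inter> cylinder ({..<s} - {k}) x = {}")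
    case True
    then show ?thesis by (simp add: W_def prod_nonneg)
  next
    case False
    then obtain y where y: "y \<in> vI m N u" "y \<in> cylinder ({..<s} - {k}) x" by blast
    then have "y \<in> space G" by (simp add: vI_def)
    then have "W = (\<Prod>i\<in>{..<N} \<union> ({..<s} - {k}). 1 / real (m i))"
      unfolding W_def vI_Int_cylinder_eq[OF y] by (intro measure_cylinder) auto
    then show ?thesis using vI_Int_cylinder_subset[OF False x] by simp
  qed
  show "W \<le> hit u x s k / real (M N)" if "s \<le> N"
  proof -
    have "{..<N} \<union> ({..<s} - {k}) = {..<N}" "({..<s} - {k}) \<inter> {..<N} = {..<s} - {k}"
      using that by auto
    then show ?thesis using W_cases by (simp add: prod_inverse_m)
  qed
  show "W \<le> hit u x N k / real (M s)" if "k < N" "N < s"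
  proof -
    have "{..<N} \<union> ({..<s} - {k}) = {..<s}" "({..<s} - {k}) \<inter> {..<N} = {..<N} - {k}"
      using that by auto
    then show ?thesis using W_cases by (simp add: prod_inverse_m)
  qed
  show "W \<le> of_bool (x \<in> vI m N u) * real B / real (M s)" if "N \<le> k"
  proof -
    have "{..<N} \<union> ({..<s} - {k}) = {..<s} - {k}" "({..<s} - {k}) \<inter> {..<N} = {..<N}"
      using that k by auto
    then have "W \<le> of_bool (x \<in> vI m N u) * (real (m k) / real (M s))"
      using W_cases by (simp add: prod_inverse_m_remove[OF k] vI_eq_cylinder)
    also have "\<dots> \<le> of_bool (x \<in> vI m N u) * (real B / real (M s))"
      using m_le[of k] by (intro mult_left_mono divide_right_mono) auto
    finally show ?thesis by simp
  qed
qed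

text \<open>Up to constants, the kernel bound at t = u cut off at the scale of the cell; rows with s
  > N will be reduced to the row s = N.\<close>

definition spread :: "nat \<Rightarrow> (nat \<Rightarrow> nat) \<Rightarrow> (nat \<Rightarrow> nat) \<Rightarrow> real" where
  "spread N u x = (\<Sum>s\<le>N. \<Sum>k<s. real (M s) * real (M k) * hit u x s k)"

lemma spread_nonneg: "spread N u x \<ge> 0"
  unfolding spread_def by (intro sum_nonneg) auto

lemma sum_overlap_le_small:
  assumes x: "x \<in> space G" and u: "u \<in> space G"
  shows "(\<Sum>s\<le>N. \<Sum>k<s. real (M s) * real (M k) * measure G (vI m N u \<inter> cylinder ({..<s} - {k}) x))
    \<le> spread N u x / real (M N)"
proof -
  have "(\<Sum>s\<le>N. \<Sum>k<s. real (M s) * real (M k) * measure G (vI m N u \<inter> cylinder ({..<s} - {k}) x))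
    \<le> (\<Sum>s\<le>N. \<Sum>k<s. real (M s) * real (M k) * (hit u x s k / real (M N)))"
    using overlap_small[OF x u] by (intro sum_mono mult_left_mono) auto
  also have "\<dots> = spread N u x / real (M N)"
    unfolding spread_def sum_divide_distrib by simp
  finally show ?thesis .
qed

text \<open>For k < N the cell pins coordinate k, and an overlap of at most 1 / M_s turns row s into
  row N of \<open>spread\<close>. For k >= N all coordinates below N must match, so x lies in the
  cell, and the M_k sum geometrically.\<close>

lemma sum_overlap_le_large:
  assumes x: "x \<in> space G" and u: "u \<in> space G" and s: "N < s"
  shows "(\<Sum>k<s. real (M s) * real (M k) * measure G (vI m N u \<inter> cylinder ({..<s} - {k}) x))
    \<le> spread N u x / real (M N) + real B * real (M s) * of_bool (x \<in> vI m N u)"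
proof -
  let ?W = "\<lambda>k. measure G (vI m N u \<inter> cylinder ({..<s} - {k}) x)"
  let ?b = "of_bool (x \<in> vI m N u) :: real"
  have "(\<Sum>k<s. real (M s) * real (M k) * ?W k) =
      (\<Sum>k<N. real (M s) * real (M k) * ?W k) + (\<Sum>k\<in>{N..<s}. real (M s) * real (M k) * ?W k)"
    using s by (subst sum.union_disjoint[symmetric]) (auto simp: ivl_disj_un)
  moreover have "(\<Sum>k<N. real (M s) * real (M k) * ?W k) \<le> spread N u x / real (M N)"
  proof -
    have "(\<Sum>k<N. real (M s) * real (M k) * ?W k) \<le> (\<Sum>k<N. real (M s) * real (M k) * (hit u x N k / real (M s)))"
      using overlap_mid[OF x u] s by (intro sum_mono mult_left_mono) auto
    also have "\<dots> = (\<Sum>k<N. real (M N) * real (M k) * hit u x N k) / real (M N)"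
      unfolding sum_divide_distrib by (intro sum.cong refl) simp
    also have "\<dots> \<le> spread N u x / real (M N)"
    proof (rule divide_right_mono)
      show "(\<Sum>k<N. real (M N) * real (M k) * hit u x N k) \<le> spread N u x"
        unfolding spread_def
        by (rule member_le_sum[of N "{..N}" "\<lambda>s. \<Sum>k<s. real (M s) * real (M k) * hit u x s k"])
          (auto intro: sum_nonneg)
    qed auto
    finally show ?thesis .
  qed
  moreover have "(\<Sum>k\<in>{N..<s}. real (M s) * real (M k) * ?W k) \<le> real B * real (M s) * ?b"
  proof -
    have "(\<Sum>k\<in>{N..<s}. real (M s) * real (M k) * ?W k) \<le> (\<Sum>k\<in>{N..<s}. real (M s) * real (M k) * (?b * real B / real (M s)))"
      using overlap_large[OF x u] by (intro sum_mono mult_left_mono) auto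
    also have "\<dots> = (\<Sum>k\<in>{N..<s}. real (M k)) * (real B * ?b)"
      unfolding sum_distrib_right by (intro sum.cong refl) simp
    also have "\<dots> \<le> (\<Sum>k<s. real (M k)) * (real B * ?b)"
      by (intro mult_right_mono sum_mono2) auto
    also have "\<dots> \<le> real (M s) * (real B * ?b)"
    proof (rule mult_right_mono)
      show "(\<Sum>k<s. real (M k)) \<le> real (M s)"
        unfolding of_nat_sum[symmetric] of_nat_le_iff by (rule sum_M_le)
    qed auto
    finally show ?thesis by (simp only: mult_ac)
  qed
  ultimately show ?thesis by linarith
qed

lemma sum_overlap_le:
  assumes x: "x \<in> space G" and u: "u \<in> space G" and n: "M A \<le> n" and NA: "N \<le> A"
  shows "(\<Sum>s\<le>Suc A. \<Sum>k<s. real (M s) * real (M k) * measure G (vI m N u \<inter> cylinder ({..<s} - {k}) x))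
    \<le> 2 * real B ^ 2 * real n * (of_bool (x \<in> vI m N u) + spread N u x / real (M N) ^ 2)"
proof -
  let ?T = "\<lambda>s. \<Sum>k<s. real (M s) * real (M k) * measure G (vI m N u \<inter> cylinder ({..<s} - {k}) x)"
  let ?b = "of_bool (x \<in> vI m N u) :: real"
  define q where "q = spread N u x / real (M N)"
  have q: "q \<ge> 0" using spread_nonneg by (simp add: q_def)
  have "(\<Sum>s\<le>Suc A. ?T s) = (\<Sum>s\<le>N. ?T s) + (\<Sum>s\<in>{N<..Suc A}. ?T s)"
  proof -
    have "{..Suc A} = {..N} \<union> {N<..Suc A}" using NA by auto
    then show ?thesis by (simp only:) (rule sum.union_disjoint, auto)
  qed
  also have "\<dots> \<le> q + (\<Sum>s\<in>{N<..Suc A}. q + real B * real (M s) * ?b)"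
    unfolding q_def using sum_overlap_le_small[OF x u] sum_overlap_le_large[OF x u]
    by (intro add_mono sum_mono) auto
  also have "\<dots> = real (Suc (Suc A - N)) * q + real B * ?b * (\<Sum>s\<in>{N<..Suc A}. real (M s))"
    by (simp add: sum.distrib sum_distrib_left algebra_simps)
  \<comment> \<open>There are A - N + 2 copies of q, at most 2 * 2^(A - N), while 2^(A - N) M_N <=
    M_A <= n. Thus the number of rows is paid by n / M_N, and no dependence on n is left after
    division by n.\<close>
  also have "\<dots> \<le> 2 * (real n / real (M N)) * q + real B * ?b * (2 * real B * real n)"
  proof (intro add_mono mult_right_mono mult_left_mono)
    have "Suc (Suc A - N) \<le> 2 * 2 ^ (A - N)"
      unfolding Suc_diff_le[OF NA] using less_exp[of "A - N"] by linarith
    then have "Suc (Suc A - N) * M N \<le> 2 * (2 ^ (A - N) * M N)" by (metis mult.assoc mult_le_mono1)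
    also have "\<dots> \<le> 2 * n" using M_add_ge[of "A - N" N] NA n by simp
    finally have "real (Suc (Suc A - N)) * real (M N) \<le> 2 * real n"
      by (metis of_nat_le_iff of_nat_mult of_nat_numeral)
    then show "real (Suc (Suc A - N)) \<le> 2 * (real n / real (M N))" by (simp add: field_simps)
    have "(\<Sum>s\<in>{N<..Suc A}. M s) \<le> (\<Sum>s<Suc (Suc A). M s)" by (intro sum_mono2) auto
    also have "\<dots> \<le> 2 * M (Suc A)" using sum_M_le[of "Suc A"] by simp
    also have "\<dots> \<le> 2 * (B * n)" using M_Suc_le[of A] n by (meson le_trans mult_le_mono2)
    finally show "(\<Sum>s\<in>{N<..Suc A}. real (M s)) \<le> 2 * real B * real n"
      unfolding of_nat_sum[symmetric] by (metis mult.assoc of_nat_le_iff of_nat_mult of_nat_numeral)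
  qed (use q in auto)
  also have "\<dots> \<le> 2 * real B ^ 2 * (real n / real (M N)) * q + real B * ?b * (2 * real B * real n)"
    using q B_ge2 by (intro add_right_mono mult_right_mono) auto
  also have "\<dots> = 2 * real B ^ 2 * real n * (?b + spread N u x / real (M N) ^ 2)"
    by (simp add: q_def power2_eq_square algebra_simps)
  finally show ?thesis .
qed

text \<open>On the whole group (\<open>N = 0\<close>) no cancellation is needed, as \<open>\<sigma>_n = 0\<close> for \<open>n \<le> M_0 = 1\<close> anyway.\<close>

definition atom :: "nat \<Rightarrow> nat \<Rightarrow> (nat \<Rightarrow> nat) \<Rightarrow> real \<Rightarrow> ((nat \<Rightarrow> nat) \<Rightarrow> complex) \<Rightarrow> bool" where
  "atom L N u C a \<longleftrightarrow> depends L a \<and> N \<le> L \<and> u \<in> space G \<and> C \<ge> 0 \<and>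
    (\<forall>t\<in>space G. norm (a t) \<le> C * of_bool (t \<in> vI m N u)) \<and> (N = 0 \<or> (\<integral>t. a t \<partial>G) = 0)"

text \<open>For n <= M_N the kernel, as a function of t, depends on the first N coordinates only, so
  it is constant on the cell and the mean zero property applies.\<close>

lemma fmean_atom_eq_0:
  assumes a: "atom L N u C a" and n: "n \<le> M N"
  shows "fmean a n x = 0"
proof (cases "N = 0")
  case True
  then have "n = 0 \<or> n = 1" using n by auto
  then show ?thesis by (auto simp: fmean_def fejer_def dirichlet_def)
next
  case False
  have "(\<integral>t. a t * fejer (rho x t) n \<partial>G) = (\<integral>t. a t * fejer (rho x u) n \<partial>G)"
  proof (rule Bochner_Integration.integral_cong[OF refl])
    fix t assume t: "t \<in> space G"
    show "a t * fejer (rho x t) n = a t * fejer (rho x u) n"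
    proof (cases "t \<in> vI m N u")
      case True
      then have "fejer (rho x t) n = fejer (rho x u) n"
        using a t by (intro dependsD[OF depends_fejer_rho[OF n]]) (auto simp: atom_def vI_def)
      then show ?thesis by simp
    next
      case False
      then have "norm (a t) \<le> 0" using a t unfolding atom_def by fastforce
      then show ?thesis by simp
    qed
  qed
  also have "\<dots> = 0" using a False by (simp add: atom_def)
  finally show ?thesis by (simp add: fmean_def)
qed

text \<open>Beyond M_N no cancellation is used: the kernel bound is integrated over the cell. The
  constant is 2 B^3 from the kernel times 2 B^2 from the overlaps.\<close>

lemma norm_fmean_atom_le:
  assumes a: "atom L N u C a" and n: "M N < n" "n \<le> M L" and x: "x \<in> space G"
  shows "norm (fmean a n x) \<le> 4 * real B ^ 5 * C * (of_bool (x \<in> vI m N u) + spread N u x / real (M N) ^ 2)"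
proof -
  have u: "u \<in> space G" and C: "C \<ge> 0" using a by (auto simp: atom_def)
  obtain A where A: "M A \<le> n" "n < M (Suc A)" using exists_M_interval[of n] n by auto
  have NA: "N \<le> A"
  proof (rule ccontr)
    assume "\<not> N \<le> A"
    then have "M (Suc A) \<le> M N" by (intro M_mono) simp
    then show False using n A by simp
  qed
  let ?w = "\<lambda>s k. real (M s) * real (M k)"
  let ?K = "2 * real B ^ 3"
  let ?W = "\<lambda>s k. vI m N u \<inter> cylinder ({..<s} - {k}) x"
  have W_sets: "?W s k \<in> sets G" for s k
    using u x by (intro sets.Int vI_sets cylinder_sets) auto
  have int: "integrable G (indicator (?W s k) :: _ \<Rightarrow> real)" for s k
    using W_sets by (intro integrable_real_indicator) (auto simp: emeasure_G)
  have pointwise: "norm (a t * fejer (rho x t) n) \<le> C * ?K * (\<Sum>s\<le>Suc A. \<Sum>k<s. ?w s k * indicator (?W s k) t)"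
    if t: "t \<in> space G" for t
  proof -
    have "norm (fejer (rho x t) n) \<le> ?K * (\<Sum>s\<le>Suc A. \<Sum>k<s. ?w s k * of_bool (\<forall>i\<in>{..<s} - {k}. x i = t i))"
      by (rule norm_fejer_le[OF norm_rho sum_rho[OF x t] A(2)])
    also have "\<dots> = ?K * (\<Sum>s\<le>Suc A. \<Sum>k<s. ?w s k * indicator (cylinder ({..<s} - {k}) x) t)"
    proof -
      have "(\<forall>i\<in>J. x i = t i) \<longleftrightarrow> t \<in> cylinder J x" for J
        using t by (simp add: cylinder_def eq_commute[of "x _"])
      then show ?thesis by (simp only: indicator_def of_bool_def)
    qed
    finally have "norm (a t) * norm (fejer (rho x t) n) \<le>
        (C * indicator (vI m N u) t) * (?K * (\<Sum>s\<le>Suc A. \<Sum>k<s. ?w s k * indicator (cylinder ({..<s} - {k}) x) t))"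
      using a t by (intro mult_mono) (auto simp: atom_def indicator_def)
    also have "\<dots> = C * ?K * (\<Sum>s\<le>Suc A. \<Sum>k<s. ?w s k * indicator (?W s k) t)"
      unfolding sum_distrib_left by (intro sum.cong refl) (simp add: indicator_inter_arith)
    finally show ?thesis unfolding norm_mult .
  qed
  have "norm (\<integral>t. a t * fejer (rho x t) n \<partial>G) \<le> (\<integral>t. C * ?K * (\<Sum>s\<le>Suc A. \<Sum>k<s. ?w s k * indicator (?W s k) t) \<partial>G)"
  proof (rule order_trans[OF integral_norm_bound], rule integral_mono)
    have "depends L a" using a by (simp add: atom_def)
    from depends_integrable[OF depends_comp2[OF this depends_fejer_rho[OF n(2)]]]
    show "integrable G (\<lambda>t. norm (a t * fejer (rho x t) n))"
      by (rule integrable_norm)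
    show "integrable G (\<lambda>t. C * ?K * (\<Sum>s\<le>Suc A. \<Sum>k<s. ?w s k * indicator (?W s k) t))"
      using int by (intro integrable_mult_right Bochner_Integration.integrable_sum)
  qed (rule pointwise)
  also have "\<dots> = C * ?K * (\<Sum>s\<le>Suc A. \<Sum>k<s. ?w s k * measure G (?W s k))"
  proof -
    have "(\<integral>t. (\<Sum>s\<le>Suc A. \<Sum>k<s. ?w s k * indicator (?W s k) t) \<partial>G)
        = (\<Sum>s\<le>Suc A. \<integral>t. (\<Sum>k<s. ?w s k * indicator (?W s k) t) \<partial>G)"
      by (intro Bochner_Integration.integral_sum Bochner_Integration.integrable_sum integrable_mult_right int)
    also have "\<dots> = (\<Sum>s\<le>Suc A. \<Sum>k<s. \<integral>t. ?w s k * indicator (?W s k) t \<partial>G)"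
      by (intro sum.cong refl Bochner_Integration.integral_sum integrable_mult_right int)
    also have "\<dots> = (\<Sum>s\<le>Suc A. \<Sum>k<s. ?w s k * measure G (?W s k))"
      using sets.sets_into_space[OF W_sets]
      by (intro sum.cong refl) (simp only: integral_mult_right_zero Bochner_Integration.integral_indicator Int_absorb2)
    finally show ?thesis by (simp only: integral_mult_right_zero)
  qed
  also have "\<dots> \<le> C * ?K * (2 * real B ^ 2 * real n * (of_bool (x \<in> vI m N u) + spread N u x / real (M N) ^ 2))"
    using sum_overlap_le[OF x u A(1) NA] C by (intro mult_left_mono) auto
  finally have "norm (\<integral>t. a t * fejer (rho x t) n \<partial>G) / real n \<le>
      C * ?K * (2 * real B ^ 2 * real n * (of_bool (x \<in> vI m N u) + spread N u x / real (M N) ^ 2)) / real n"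
    by (intro divide_right_mono) auto
  also have "\<dots> = 4 * real B ^ 5 * C * (of_bool (x \<in> vI m N u) + spread N u x / real (M N) ^ 2)"
    using n by (simp add: eval_nat_numeral)
  finally show ?thesis unfolding fmean_def norm_divide norm_of_nat .
qed

section \<open>Integrable majorant for the weighted means of an atom\<close>

text \<open>Up to a constant times \<open>sqrt C\<close>, this dominates |sigma_n a|^(1/2) / log (n
  + 1) for all n from 1 to M_L at once. The denominator N + 1 is what the logarithm contributes; on
  the cell itself that gain is given up.\<close>

definition atom_weight :: "nat \<Rightarrow> (nat \<Rightarrow> nat) \<Rightarrow> (nat \<Rightarrow> nat) \<Rightarrow> real" where
  "atom_weight N u x = of_bool (x \<in> vI m N u) +
    (\<Sum>s\<le>N. \<Sum>k<s. sqrt (real (M s) * real (M k)) * hit u x s k) / (real (N + 1) * real (M N))"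

lemma atom_weight_nonneg: "atom_weight N u x \<ge> 0"
  unfolding atom_weight_def by (intro add_nonneg_nonneg divide_nonneg_nonneg sum_nonneg) auto

lemma sqrt_spread_le:
  "sqrt (spread N u x) \<le> (\<Sum>s\<le>N. \<Sum>k<s. sqrt (real (M s) * real (M k)) * hit u x s k)"
proof -
  have "sqrt (spread N u x) \<le> (\<Sum>s\<le>N. sqrt (\<Sum>k<s. real (M s) * real (M k) * hit u x s k))"
    unfolding spread_def by (intro sqrt_sum_le sum_nonneg) auto
  also have "\<dots> \<le> (\<Sum>s\<le>N. \<Sum>k<s. sqrt (real (M s) * real (M k) * hit u x s k))"
    by (intro sum_mono sqrt_sum_le) auto
  also have "\<dots> = (\<Sum>s\<le>N. \<Sum>k<s. sqrt (real (M s) * real (M k)) * hit u x s k)"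
    by (intro sum.cong refl) (simp add: real_sqrt_mult)
  finally show ?thesis .
qed

text \<open>n > M_N >= 2^N gives the lower bound N/2, and ln 2 gives 1/2, which covers N = 0; the
  right-hand side is their average.\<close>

lemma ln_ge_level:
  assumes "M N < n"
  shows "ln (real n + 1) \<ge> real (N + 1) / 4"
proof -
  have ln2: "ln 2 \<ge> (1 / 2 :: real)" using ln2_ge_two_thirds by simp
  have "2 ^ N \<le> real n"
  proof -
    have "2 ^ N \<le> n" using M_ge_power[of N] assms by simp
    then show ?thesis by (metis of_nat_le_iff of_nat_numeral of_nat_power)
  qed
  then have "2 ^ N \<le> real n + 1" by linarith
  then have "ln (2 ^ N) \<le> ln (real n + 1)" by (rule iffD2[OF ln_le_cancel_iff, rotated 2]) auto
  then have 1: "real N * ln 2 \<le> ln (real n + 1)" by (simp add: ln_realpow)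
  have 2: "ln 2 \<le> ln (real n + 1)"
    using assms by (intro iffD2[OF ln_le_cancel_iff]) auto
  have "real N * (1 / 2) \<le> real N * ln 2" using ln2 by (intro mult_left_mono) auto
  also note 1
  finally have 3: "real N / 2 \<le> ln (real n + 1)" by simp
  have 4: "1 / 2 \<le> ln (real n + 1)" using 2 ln2 by (rule order_trans[rotated])
  have "real (N + 1) / 4 = real N / 2 / 2 + 1 / 2 / 2" by simp
  then show ?thesis using 3 4 by linarith
qed

lemma sqrt_fmean_atom_le:
  assumes a: "atom L N u C a" and n: "1 \<le> n" "n \<le> M L" and x: "x \<in> space G"
  shows "sqrt (norm (fmean a n x)) / ln (real n + 1) \<le> 8 * real B ^ 3 * sqrt C * atom_weight N u x"
proof (cases "n \<le> M N")
  case True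
  have "C \<ge> 0" using a by (simp add: atom_def)
  then show ?thesis using fmean_atom_eq_0[OF a True] atom_weight_nonneg[of N u x] by simp
next
  case False
  then have Nn: "M N < n" by simp
  have C: "C \<ge> 0" using a by (simp add: atom_def)
  let ?b = "of_bool (x \<in> vI m N u) :: real"
  let ?s = "\<Sum>s\<le>N. \<Sum>k<s. sqrt (real (M s) * real (M k)) * hit u x s k"
  have s: "?s \<ge> 0" by (intro sum_nonneg) auto
  have B5: "sqrt (4 * real B ^ 5) \<le> 2 * real B ^ 3"
  proof (rule real_le_lsqrt)
    have "real B ^ 5 \<le> real B ^ 6" using B_ge2 by (intro power_increasing) auto
    then show "4 * real B ^ 5 \<le> (2 * real B ^ 3)\<^sup>2" by (simp add: power_mult_distrib flip: power_mult)
  qed auto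
  have "sqrt (norm (fmean a n x)) \<le> sqrt (4 * real B ^ 5 * C * (?b + spread N u x / real (M N) ^ 2))"
    by (rule real_sqrt_le_mono[OF norm_fmean_atom_le[OF a Nn n(2) x]])
  also have "\<dots> = sqrt (4 * real B ^ 5) * sqrt C * sqrt (?b + spread N u x / real (M N) ^ 2)"
    by (simp add: real_sqrt_mult)
  also have "\<dots> \<le> (2 * real B ^ 3) * sqrt C * (?b + ?s / real (M N))"
  proof (intro mult_mono B5)
    have "sqrt (?b + spread N u x / real (M N) ^ 2) \<le> sqrt ?b + sqrt (spread N u x / real (M N) ^ 2)"
      using spread_nonneg by (intro sqrt_add_le_add_sqrt) auto
    also have "\<dots> = ?b + sqrt (spread N u x) / real (M N)"
      by (simp add: real_sqrt_divide)
    also have "\<dots> \<le> ?b + ?s / real (M N)"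
      by (intro add_left_mono divide_right_mono sqrt_spread_le) auto
    finally show "sqrt (?b + spread N u x / real (M N) ^ 2) \<le> ?b + ?s / real (M N)" .
  qed (use C spread_nonneg in auto)
  finally have 1: "sqrt (norm (fmean a n x)) \<le> (2 * real B ^ 3) * sqrt C * (?b + ?s / real (M N))" .
  have 2: "1 / ln (real n + 1) \<le> 4 / real (N + 1)"
  proof -
    have "1 / ln (real n + 1) \<le> 1 / (real (N + 1) / 4)"
      by (rule divide_left_mono[OF ln_ge_level[OF Nn]]) (use n in auto)
    then show ?thesis by simp
  qed
  have alg: "(2 * b3 * c * (b + q / Mn)) * (4 / n1) = 8 * b3 * c * (b / n1 + q / (n1 * Mn))"
    for b3 c b q Mn n1 :: real
    by (simp add: divide_inverse algebra_simps)
  have "sqrt (norm (fmean a n x)) * (1 / ln (real n + 1)) \<le>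
      ((2 * real B ^ 3) * sqrt C * (?b + ?s / real (M N))) * (4 / real (N + 1))"
    using n C s by (intro mult_mono 1 2) (auto intro!: mult_nonneg_nonneg)
  also have "\<dots> = 8 * real B ^ 3 * sqrt C * (?b / real (N + 1) + ?s / (real (N + 1) * real (M N)))"
    by (rule alg)
  also have "\<dots> \<le> 8 * real B ^ 3 * sqrt C * atom_weight N u x"
    unfolding atom_weight_def using C by (intro mult_left_mono add_right_mono) (auto simp: field_simps)
  finally show ?thesis by simp
qed

text \<open>\<open>M\<close> at least doubles, and the induction closes because 1 + 3 <= 3 sqrt
  2.\<close>

lemma sum_sqrt_M_le: "(\<Sum>k<s. sqrt (real (M k))) \<le> 3 * sqrt (real (M s))"
proof (induction s)
  case (Suc s)
  have "sqrt (16 * real (M s)) \<le> sqrt (9 * real (M (Suc s)))"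
    using M_Suc_ge[of s] by (intro real_sqrt_le_mono) linarith
  then have "4 * sqrt (real (M s)) \<le> 3 * sqrt (real (M (Suc s)))"
    by (simp add: real_sqrt_mult)
  then show ?case using Suc by simp
qed simp

lemma integrable_cylinder:
  assumes "finite J" "u \<in> space G"
  shows "integrable G (\<lambda>x. of_bool (x \<in> cylinder J u) :: real)"
    and "(\<integral>x. of_bool (x \<in> cylinder J u) \<partial>G) = measure G (cylinder J u)"
proof -
  have eq: "(\<lambda>x. of_bool (x \<in> cylinder J u) :: real) = indicator (cylinder J u)"
    by (auto simp: indicator_def)
  have "cylinder J u \<subseteq> space G" by (auto simp: cylinder_def)
  then show "integrable G (\<lambda>x. of_bool (x \<in> cylinder J u) :: real)"
    and "(\<integral>x. of_bool (x \<in> cylinder J u) \<partial>G) = measure G (cylinder J u)"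
    unfolding eq using cylinder_sets[OF assms] by (auto simp: emeasure_G Int_absorb2)
qed

text \<open>The set behind \<open>hit u x s k\<close> has measure m_k / M_s, so row s integrates to
  at most B times the sum of sqrt (M_k / M_s) over k < s, hence to at most 3 B whatever s is. The N
  + 1 rows give 3 B (N + 1), and the denominator in \<open>atom_weight\<close> cancels N + 1
  exactly.\<close>

lemma
  assumes u: "u \<in> space G"
  shows integrable_atom_weight: "integrable G (atom_weight N u)"
    and integral_atom_weight_le: "(\<integral>x. atom_weight N u x \<partial>G) \<le> (1 + 3 * real B) * measure G (vI m N u)"
proof -
  note int = integrable_cylinder[OF _ u]
  have int_sum: "integrable G (\<lambda>x. \<Sum>s\<le>N. \<Sum>k<s. sqrt (real (M s) * real (M k)) * hit u x s k)"
    by (intro Bochner_Integration.integrable_sum integrable_mult_right int) auto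
  show "integrable G (atom_weight N u)"
    unfolding atom_weight_def vI_eq_cylinder
    by (intro Bochner_Integration.integrable_add integrable_divide int_sum int) auto
  have "(\<integral>x. (\<Sum>s\<le>N. \<Sum>k<s. sqrt (real (M s) * real (M k)) * hit u x s k) \<partial>G)
      = (\<Sum>s\<le>N. \<Sum>k<s. sqrt (real (M s) * real (M k)) * (real (m k) / real (M s)))"
    using int u by (subst Bochner_Integration.integral_sum, intro Bochner_Integration.integrable_sum integrable_mult_right int, simp)
      (intro sum.cong refl, subst Bochner_Integration.integral_sum, 
        auto simp: measure_cylinder_remove)
  also have "\<dots> \<le> (\<Sum>s\<le>N. 3 * real B)"
  proof (rule sum_mono)
    fix s
    have "(\<Sum>k<s. sqrt (real (M s) * real (M k)) * (real (m k) / real (M s)))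
        \<le> (\<Sum>k<s. sqrt (real (M s) * real (M k)) * (real B / real (M s)))"
      using m_le by (intro sum_mono mult_left_mono divide_right_mono) auto
    also have "\<dots> = (\<Sum>k<s. sqrt (real (M k))) * (sqrt (real (M s)) * real B / real (M s))"
      unfolding sum_distrib_right by (intro sum.cong refl) (simp add: real_sqrt_mult)
    also have "\<dots> \<le> (3 * sqrt (real (M s))) * (sqrt (real (M s)) * real B / real (M s))"
      by (intro mult_right_mono sum_sqrt_M_le) auto
    also have "\<dots> = 3 * real B * (sqrt (real (M s)) * sqrt (real (M s))) / real (M s)"
      by (simp only: times_divide_eq_right mult_ac)
    also have "\<dots> = 3 * real B" by simp
    finally show "(\<Sum>k<s. sqrt (real (M s) * real (M k)) * (real (m k) / real (M s))) \<le> 3 * real B" .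
  qed
  finally have S: "(\<integral>x. (\<Sum>s\<le>N. \<Sum>k<s. sqrt (real (M s) * real (M k)) * hit u x s k) \<partial>G) \<le> 3 * real B * real (N + 1)"
    by (simp add: mult.commute)
  have "(\<integral>x. atom_weight N u x \<partial>G) = (\<integral>x. of_bool (x \<in> cylinder {..<N} u) \<partial>G) +
      (\<integral>x. (\<Sum>s\<le>N. \<Sum>k<s. sqrt (real (M s) * real (M k)) * hit u x s k) / (real (N + 1) * real (M N)) \<partial>G)"
    unfolding atom_weight_def vI_eq_cylinder
    by (intro Bochner_Integration.integral_add integrable_divide int_sum int finite_lessThan)
  also have "\<dots> = measure G (vI m N u) +
      (\<integral>x. (\<Sum>s\<le>N. \<Sum>k<s. sqrt (real (M s) * real (M k)) * hit u x s k) \<partial>G) / (real (N + 1) * real (M N))"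
    by (simp only: int finite_lessThan integral_divide_zero vI_eq_cylinder)
  also have "\<dots> \<le> measure G (vI m N u) + (3 * real B * real (N + 1)) / (real (N + 1) * real (M N))"
    by (intro add_left_mono divide_right_mono S) auto
  also have "\<dots> = (1 + 3 * real B) * measure G (vI m N u)"
  proof -
    have "(b * n1) / (n1 * Mn) = b * (1 / Mn)" if "n1 \<noteq> 0" for b n1 Mn :: real
      using that by simp
    from this[of "real (N + 1)"] show ?thesis
      by (simp only: measure_vI[OF u]) (simp add: distrib_right add_divide_distrib)
  qed
  finally show "(\<integral>x. atom_weight N u x \<partial>G) \<le> (1 + 3 * real B) * measure G (vI m N u)" .
qed

subsection \<open>The atomic decomposition\<close>

context
  fixes f :: "nat \<Rightarrow> (nat \<Rightarrow> nat) \<Rightarrow> complex" and L :: nat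
  assumes f: "vmartingale m f"
begin

text \<open>The bound on \<open>f n\<close> is tested on the cell of level \<open>n - 1\<close>, which makes the stopping rule predictable.
  Subtraction is truncated: \<open>f 0\<close> and \<open>f 1\<close> are both tested on the whole group.\<close>

definition good :: "real \<Rightarrow> nat \<Rightarrow> (nat \<Rightarrow> nat) \<Rightarrow> bool" where
  "good c j x \<longleftrightarrow> (\<forall>n\<le>j. \<forall>y\<in>vI m (n - 1) x. norm (f n y) \<le> c)"

text \<open>A martingale transform: \<open>good c (Suc i)\<close> is known at time i, and once it
  fails it stays false, which freezes the value. If even \<open>good c 0\<close> fails, the value is
  0.\<close>

definition stopped :: "real \<Rightarrow> nat \<Rightarrow> (nat \<Rightarrow> nat) \<Rightarrow> complex" where
  "stopped c j x = of_bool (good c 0 x) * f 0 x + (\<Sum>i<j. of_bool (good c (Suc i) x) * (f (Suc i) x - f i x))"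

text \<open>A property of the cell \<open>vI m N x\<close>: N is the first level at which a cell
  around x is rejected. Since f n is tested at level n - 1, the case N = 0 collects both n = 0 and n
  = 1.\<close>

definition stops :: "real \<Rightarrow> nat \<Rightarrow> (nat \<Rightarrow> nat) \<Rightarrow> bool" where
  "stops c N x \<longleftrightarrow> (\<exists>n\<le>L. n - 1 = N \<and> (\<exists>y\<in>vI m N x. norm (f n y) > c)) \<and>
     (\<forall>n\<le>L. n - 1 < N \<longrightarrow> (\<forall>y\<in>vI m (n - 1) x. norm (f n y) \<le> c))"

lemma depends_f: "depends n (f n)"
  by (rule vmartingale_depends[OF f])

lemma good_antimono: "good c j x \<Longrightarrow> i \<le> j \<Longrightarrow> good c i x"
  by (auto simp: good_def)

lemma good_mono: "good c j x \<Longrightarrow> c \<le> c' \<Longrightarrow> good c' j x"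
  unfolding good_def by (blast intro: order_trans)

lemma vI_cong: "(\<And>i. i < n \<Longrightarrow> x i = y i) \<Longrightarrow> vI m n x = vI m n y"
  by (auto simp: vI_def)

lemma depends_good: "depends (j - 1) (good c j)"
proof (rule dependsI)
  fix x y :: "nat \<Rightarrow> nat" assume xy: "\<And>i. i < j - 1 \<Longrightarrow> x i = y i"
  have "vI m (n - 1) x = vI m (n - 1) y" if "n \<le> j" for n
    using that by (intro vI_cong xy) simp
  then show "good c j x = good c j y" by (simp add: good_def)
qed

lemma depends_stops: "depends N (stops c N)"
proof (rule dependsI)
  fix x y :: "nat \<Rightarrow> nat" assume xy: "\<And>i. i < N \<Longrightarrow> x i = y i"
  have "vI m n x = vI m n y" if "n \<le> N" for n
    using that by (intro vI_cong xy) simp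
  then show "stops c N x = stops c N y" by (simp add: stops_def)
qed

lemma depends_stopped: "depends L (stopped c L)"
proof -
  have 0: "depends L (\<lambda>x. of_bool (good c 0 x) * f 0 x)"
    by (rule depends_comp2[where g = "good c 0" and g' = "f 0", OF depends_mono[OF depends_good] depends_mono[OF depends_f]]) auto
  have i: "depends L (\<lambda>x. of_bool (good c (Suc i) x) * (f (Suc i) x - f i x))" if "i < L" for i
    using that by (intro depends_comp2[where g = "good c (Suc i)" and g' = "\<lambda>x. f (Suc i) x - f i x" and h = "\<lambda>a b. of_bool a * b"]
      depends_comp2[where g = "f (Suc i)" and g' = "f i" and h = "(-)"] depends_mono[OF depends_good] depends_mono[OF depends_f]) auto
  show ?thesis
    unfolding stopped_def
    by (rule depends_comp2[where h = "(+)", OF 0 depends_sum]) (rule i, simp)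
qed

lemma stopped_Suc:
  "stopped c (Suc j) x = stopped c j x + of_bool (good c (Suc j) x) * (f (Suc j) x - f j x)"
  by (simp only: stopped_def sum.lessThan_Suc add.assoc)

lemma good_imp_stopped_eq: "good c j x \<Longrightarrow> stopped c j x = f j x"
proof (induction j)
  case (Suc j)
  then show ?case using good_antimono[of c "Suc j" x j] by (simp add: stopped_Suc)
qed (simp add: stopped_def)

lemma mem_vI_self: "x \<in> space G \<Longrightarrow> x \<in> vI m n x"
  by (simp add: vI_def)

text \<open>While \<open>good\<close> holds, the value is that of f, and the test includes x itself;
  when it fails, the step is not taken. As the test precedes the step, there is no
  overshoot.\<close>

lemma norm_stopped_le:
  assumes "x \<in> space G" "c \<ge> 0"
  shows "norm (stopped c j x) \<le> c"
proof (induction j)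
  case 0
  then show ?case using assms mem_vI_self[of x 0] by (simp add: stopped_def good_def)
next
  case (Suc j)
  show ?case
  proof (cases "good c (Suc j) x")
    case True
    then show ?thesis
      using assms mem_vI_self[of x j] by (simp add: good_imp_stopped_eq) (simp add: good_def)
  next
    case False
    then have "stopped c (Suc j) x = stopped c j x" by (simp add: stopped_Suc)
    then show ?thesis using Suc by simp
  qed
qed

lemma stops_unique:
  assumes "stops c N x" "stops c N' x"
  shows "N = N'"
proof -
  have "\<not> N < N'" if "stops c N x" "stops c N' x" for N N'
    using that unfolding stops_def by (metis linorder_not_less)
  then show ?thesis using assms by (meson linorder_neqE_nat)
qed

lemma not_good_imp_stops:
  assumes "\<not> good c L x"
  obtains N where "N \<le> L" "stops c N x"
proof -
  define P where "P n \<longleftrightarrow> n \<le> L \<and> (\<exists>y\<in>vI m (n - 1) x. norm (f n y) > c)" for n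
  have ex: "\<exists>n. P n" using assms by (auto simp: good_def P_def not_le)
  define n where "n = (LEAST n. P n)"
  have Pn: "P n" unfolding n_def using ex by (rule LeastI_ex)
  have "stops c (n - 1) x"
    unfolding stops_def
  proof (intro conjI allI impI ballI)
    show "\<exists>k\<le>L. k - 1 = n - 1 \<and> (\<exists>y\<in>vI m (n - 1) x. norm (f k y) > c)"
      using Pn unfolding P_def by blast
    fix k y assume k: "k \<le> L" "k - 1 < n - 1" "y \<in> vI m (k - 1) x"
    then have "k < n" by linarith
    then have "\<not> P k" unfolding n_def by (rule not_less_Least)
    then show "norm (f k y) \<le> c" using k by (auto simp: P_def not_less)
  qed
  moreover have "n - 1 \<le> L" using Pn by (auto simp: P_def)
  ultimately show ?thesis using that by blast
qed

lemma stops_imp_good: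
  assumes "stops c N x" "N \<ge> 1" "i \<le> N" "N \<le> L"
  shows "good c i x"
  unfolding good_def
proof (intro allI impI)
  fix n assume "n \<le> i"
  then have "n - 1 < N" "n \<le> L" using assms by linarith+
  then show "\<forall>y\<in>vI m (n - 1) x. norm (f n y) \<le> c" using assms(1) unfolding stops_def by blast
qed

lemma good_imp_not_stops: "good c L x \<Longrightarrow> \<not> stops c N x"
  by (auto simp: good_def stops_def not_less)

definition increment :: "real \<Rightarrow> real \<Rightarrow> (nat \<Rightarrow> nat) \<Rightarrow> complex" where
  "increment c c' x = stopped c' L x - stopped c L x"

text \<open>Distinct stopping cells are disjoint, so only the one containing x survives. This
  evaluates sums over all stopping cells pointwise.\<close>

lemma sum_stops:
  fixes h :: "nat \<Rightarrow> (nat \<Rightarrow> nat) \<Rightarrow> 'b::comm_monoid_add"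
  assumes "x \<in> space G" "stops c N x" "N \<le> L" "\<And>k u. u \<in> reps k \<Longrightarrow> x \<notin> vI m k u \<Longrightarrow> h k u = 0"
  shows "(\<Sum>k\<le>L. \<Sum>u\<in>reps k. if stops c k u then h k u else 0) = h N (trunc N x)"
proof -
  have "(\<Sum>u\<in>reps k. if stops c k u then h k u else 0) = (if k = N then h k (trunc k x) else 0)" for k
  proof -
    have "(\<Sum>u\<in>reps k. if stops c k u then h k u else 0)
        = (\<Sum>u\<in>reps k. if x \<in> vI m k u then (if stops c k u then h k u else 0) else 0)"
      using assms(4) by (intro sum.cong refl) auto
    also have "\<dots> = (if stops c k (trunc k x) then h k (trunc k x) else 0)"
      by (rule sum_reps[OF assms(1)])
    also have "stops c k (trunc k x) \<longleftrightarrow> stops c k x"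
      using depends_trunc[OF depends_stops assms(1)] by simp
    also have "\<dots> \<longleftrightarrow> k = N" using stops_unique assms(2) by blast
    finally show ?thesis .
  qed
  then show ?thesis using assms(3) by simp
qed

lemma sum_stops_good:
  fixes h :: "nat \<Rightarrow> (nat \<Rightarrow> nat) \<Rightarrow> 'b::comm_monoid_add"
  assumes "x \<in> space G" "good c L x" "\<And>k u. u \<in> reps k \<Longrightarrow> x \<notin> vI m k u \<Longrightarrow> h k u = 0"
  shows "(\<Sum>k\<le>L. \<Sum>u\<in>reps k. if stops c k u then h k u else 0) = 0"
proof (intro sum.neutral ballI)
  fix k u assume u: "u \<in> reps k"
  show "(if stops c k u then h k u else 0) = 0"
  proof (cases "x \<in> vI m k u")
    case True
    then have "stops c k u \<longleftrightarrow> stops c k x"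
      using reps_space[OF u] by (intro dependsD[OF depends_stops]) (auto simp: vI_def)
    then show ?thesis using good_imp_not_stops[OF assms(2)] by simp
  qed (use assms(3) u in auto)
qed

text \<open>Where the test at level c never fails, both stopped martingales equal f L and the
  increment is 0. Every other x lies in exactly one stopping cell for c.\<close>

lemma increment_decomposition:
  assumes x: "x \<in> space G" and c: "c \<le> c'"
  shows "increment c c' x = (\<Sum>N\<le>L. \<Sum>u\<in>reps N. if stops c N u then of_bool (x \<in> vI m N u) * increment c c' x else 0)"
proof (cases "good c L x")
  case True
  then have "increment c c' x = 0"
    using good_imp_stopped_eq[of c L x] good_imp_stopped_eq[OF good_mono[OF True c]] by (simp add: increment_def)
  then show ?thesis using sum_stops_good[OF x True, of "\<lambda>N u. of_bool (x \<in> vI m N u) * increment c c' x"] by simp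
next
  case False
  then obtain N where N: "N \<le> L" "stops c N x" by (rule not_good_imp_stops)
  have "x \<in> vI m N (trunc N x)" using x by (simp add: mem_vI_reps_iff trunc_in_reps)
  then show ?thesis using sum_stops[OF x N(2,1), of "\<lambda>N u. of_bool (x \<in> vI m N u) * increment c c' x"] by simp
qed

lemma depends_increment: "depends L (increment c c')"
  unfolding increment_def by (rule depends_comp2[OF depends_stopped depends_stopped])

text \<open>On the cell both stopped martingales follow f up to time N, so their difference contains
  only the steps from i to i + 1 with i >= N, each multiplied by a factor \<open>g i\<close> known
  at time i; the martingale property makes every such integral 0. For N = 0 the starting value f 0
  may survive in the difference.\<close>

lemma integral_increment_eq_0:
  assumes u: "u \<in> space G" and N: "N \<ge> 1" "N \<le> L" and stop: "stops c N u" and c: "c \<le> c'"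
  shows "(\<integral>x. of_bool (x \<in> vI m N u) * increment c c' x \<partial>G) = 0"
proof -
  define g where "g i x = (of_bool (x \<in> vI m N u) * (of_bool (good c' (Suc i) x) - of_bool (good c (Suc i) x)) :: complex)" for i x
  have good_cell: "good c i x \<and> good c' i x" if "x \<in> vI m N u" "i \<le> N" for i x
  proof -
    have "stops c N x \<longleftrightarrow> stops c N u"
      using that u by (intro dependsD[OF depends_stops]) (auto simp: vI_def)
    then have "good c i x" using stops_imp_good[OF _ N(1) that(2) N(2)] stop by simp
    then show ?thesis using good_mono c by blast
  qed
  have g0: "g i x = 0" if "i < N" for i x
    using good_cell[of x "Suc i"] that by (auto simp: g_def)
  have g_dep: "depends i (g i)" if "N \<le> i" for i
  proof -
    have good: "depends i (good c (Suc i))" for c using depends_good[of "Suc i" c] by simp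
    show ?thesis
      unfolding g_def
      by (intro depends_comp2[where g = "\<lambda>x. x \<in> vI m N u" and h = "\<lambda>a b. of_bool a * b"]
          depends_mono[OF depends_vI that]
          depends_comp2[where g = "good c' (Suc i)" and g' = "good c (Suc i)" and h = "\<lambda>a b. of_bool a - of_bool b"] good)
  qed
  have prod_int: "integrable G (\<lambda>x. f j x * g i x)" for i j
  proof -
    have "depends (max i (max j N)) (g i)"
    proof (cases "N \<le> i")
      case True
      then show ?thesis by (intro depends_mono[OF g_dep]) auto
    next
      case False
      then show ?thesis by (intro dependsI) (simp add: g0)
    qed
    then show ?thesis
      by (intro depends_integrable[OF depends_comp2[where h = "(*)", OF depends_mono[OF depends_f]]]) auto
  qed
  have zero: "(\<integral>x. f (Suc i) x * g i x - f i x * g i x \<partial>G) = 0" for i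
  proof (cases "i < N")
    case True
    then show ?thesis by (simp add: g0)
  next
    case False
    then show ?thesis
      using martingale_integral_Suc[OF f g_dep[of i]] by (subst Bochner_Integration.integral_diff) (auto simp: prod_int)
  qed
  have "of_bool (x \<in> vI m N u) * increment c c' x = (\<Sum>i<L. f (Suc i) x * g i x - f i x * g i x)" for x
  proof (cases "x \<in> vI m N u")
    case True
    then have "good c 0 x" "good c' 0 x" using good_cell[of x 0] by auto
    with True show ?thesis
      by (simp add: increment_def stopped_def g_def sum_subtractf[symmetric] left_diff_distrib right_diff_distrib mult.commute)
        (intro sum.cong refl, simp)
  next
    case False
    then show ?thesis by (simp add: g_def)
  qed
  then have "(\<integral>x. of_bool (x \<in> vI m N u) * increment c c' x \<partial>G) = (\<integral>x. (\<Sum>i<L. f (Suc i) x * g i x - f i x * g i x) \<partial>G)"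
    by (simp only:)
  also have "\<dots> = (\<Sum>i<L. \<integral>x. f (Suc i) x * g i x - f i x * g i x \<partial>G)"
    by (intro Bochner_Integration.integral_sum Bochner_Integration.integrable_diff prod_int)
  also have "\<dots> = 0" by (simp only: zero sum.neutral_const)
  finally show ?thesis .
qed

lemma atom_increment:
  assumes u: "u \<in> space G" and N: "N \<le> L" and stop: "stops c N u" and c: "0 \<le> c" "c \<le> c'"
  shows "atom L N u (c + c') (\<lambda>x. of_bool (x \<in> vI m N u) * increment c c' x)"
  unfolding atom_def
proof (intro conjI ballI)
  show "depends L (\<lambda>x. of_bool (x \<in> vI m N u) * increment c c' x)"
    by (rule depends_comp2[where g = "\<lambda>x. x \<in> vI m N u" and h = "\<lambda>a b. of_bool a * b", OF depends_mono[OF depends_vI N] depends_increment])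
  show "norm (of_bool (t \<in> vI m N u) * increment c c' t) \<le> (c + c') * of_bool (t \<in> vI m N u)"
    if "t \<in> space G" for t
  proof -
    have "norm (increment c c' t) \<le> c' + c"
      unfolding increment_def using c norm_stopped_le[OF that, of c L] norm_stopped_le[OF that, of c' L]
      by (intro order_trans[OF norm_triangle_ineq4]) simp
    then show ?thesis by simp
  qed
  show "N = 0 \<or> (\<integral>t. of_bool (t \<in> vI m N u) * increment c c' t \<partial>G) = 0"
    using integral_increment_eq_0[OF u _ N stop c(2)] by (cases "N = 0") auto
qed (use u N c in auto)

section \<open>Measure of the stopping cells\<close>

definition level_set :: "real \<Rightarrow> (nat \<Rightarrow> nat) set" where
  "level_set c = {x \<in> space G. \<exists>n\<le>L. norm (f n x) > c}"

lemma level_set_sets: "level_set c \<in> sets G"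
  unfolding level_set_def
proof (rule depends_sets, rule dependsI)
  fix x y assume xy: "x \<in> space G" "y \<in> space G" "\<And>i. i < L \<Longrightarrow> x i = y i"
  have "f n x = f n y" if "n \<le> L" for n
    by (rule dependsD[OF depends_mono[OF depends_f that] xy])
  then show "(\<exists>n\<le>L. norm (f n x) > c) = (\<exists>n\<le>L. norm (f n y) > c)" by auto
qed

text \<open>f n is constant on cells of level n, and n <= N + 1, so one bad point makes a whole
  subcell bad, and this subcell carries at least 1/B of the measure. This is the price of
  predictable stopping, finite because m is bounded.\<close>

lemma measure_stop_cell_le:
  assumes u: "u \<in> space G" and stop: "stops c N u"
  shows "measure G (vI m N u) \<le> real B * measure G (vI m N u \<inter> level_set c)"
proof -
  obtain n y where n: "n \<le> L" "n - 1 = N" and y: "y \<in> vI m N u" "norm (f n y) > c"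
    using stop unfolding stops_def by blast
  have yG: "y \<in> space G" using y by (simp add: vI_def)
  have sub: "vI m n y \<subseteq> vI m N u \<inter> level_set c"
  proof
    fix z assume z: "z \<in> vI m n y"
    then have "f n z = f n y" using yG by (intro dependsD[OF depends_f[of n]]) (auto simp: vI_def)
    then have "z \<in> level_set c" using z y n by (auto simp: level_set_def vI_def)
    then show "z \<in> vI m N u \<inter> level_set c" using z y n by (auto simp: vI_def)
  qed
  have "M n \<le> B * M N"
    using M_Suc_le[of N] n B_ge2 by (cases n) auto
  then have "real (M n) \<le> real B * real (M N)" by (metis of_nat_le_iff of_nat_mult)
  then have "measure G (vI m N u) \<le> real B * measure G (vI m n y)"
    by (simp add: measure_vI u yG field_simps)
  also have "\<dots> \<le> real B * measure G (vI m N u \<inter> level_set c)"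
    using prob_space_G sub u level_set_sets
    by (intro mult_left_mono finite_measure.finite_measure_mono) (auto simp: prob_space_def)
  finally show ?thesis .
qed

text \<open>The stopping cells are disjoint, so the indicators of their parts inside the level set
  add up to at most its indicator.\<close>

lemma sum_stop_cells_le:
  "(\<Sum>N\<le>L. \<Sum>u\<in>reps N. if stops c N u then measure G (vI m N u) else 0) \<le> real B * measure G (level_set c)"
proof -
  let ?E = "\<lambda>N u. vI m N u \<inter> level_set c"
  have sets: "?E N u \<in> sets G" if "u \<in> reps N" for N u
    using reps_space[OF that] level_set_sets by auto
  have int: "integrable G (indicator A :: _ \<Rightarrow> real)" if "A \<in> sets G" for A
    using that by (intro integrable_real_indicator) (auto simp: emeasure_G)
  have "(\<Sum>N\<le>L. \<Sum>u\<in>reps N. if stops c N u then measure G (vI m N u) else 0)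
      \<le> (\<Sum>N\<le>L. \<Sum>u\<in>reps N. real B * (if stops c N u then measure G (?E N u) else 0))"
    by (intro sum_mono) (auto intro: measure_stop_cell_le reps_space)
  also have "\<dots> = real B * (\<Sum>N\<le>L. \<Sum>u\<in>reps N. if stops c N u then measure G (?E N u) else 0)"
    by (simp only: sum_distrib_left)
  also have "\<dots> = real B * (\<Sum>N\<le>L. \<Sum>u\<in>reps N. \<integral>x. (if stops c N u then indicator (?E N u) x else 0) \<partial>G)"
    using sets.sets_into_space[OF sets]
    by (intro arg_cong2[where f = "(*)"] sum.cong refl) (auto simp: Int_absorb2)
  also have "\<dots> = real B * (\<integral>x. (\<Sum>N\<le>L. \<Sum>u\<in>reps N. if stops c N u then indicator (?E N u) x else 0) \<partial>G)"
  proof -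
    have i: "integrable G (\<lambda>x. if stops c N u then indicator (?E N u) x else 0 :: real)" if "u \<in> reps N" for N u
      using int[OF sets[OF that]] by (cases "stops c N u") simp_all
    have "(\<integral>x. (\<Sum>N\<le>L. \<Sum>u\<in>reps N. if stops c N u then indicator (?E N u) x else 0 :: real) \<partial>G)
        = (\<Sum>N\<le>L. \<integral>x. (\<Sum>u\<in>reps N. if stops c N u then indicator (?E N u) x else 0 :: real) \<partial>G)"
      by (intro Bochner_Integration.integral_sum Bochner_Integration.integrable_sum i)
    also have "\<dots> = (\<Sum>N\<le>L. \<Sum>u\<in>reps N. \<integral>x. (if stops c N u then indicator (?E N u) x else 0) \<partial>G)"
      by (intro sum.cong refl Bochner_Integration.integral_sum i)
    finally show ?thesis by (simp only:)
  qed
  also have "\<dots> \<le> real B * (\<integral>x. indicator (level_set c) x \<partial>G)"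
  proof (intro mult_left_mono integral_mono)
    show "integrable G (\<lambda>x. \<Sum>N\<le>L. \<Sum>u\<in>reps N. if stops c N u then indicator (?E N u) x else 0 :: real)"
    proof (intro Bochner_Integration.integrable_sum)
      fix N u assume "u \<in> reps N"
      then show "integrable G (\<lambda>x. if stops c N u then indicator (?E N u) x else 0 :: real)"
        using int[OF sets] by (cases "stops c N u") simp_all
    qed
    show "integrable G (indicator (level_set c) :: _ \<Rightarrow> real)" by (rule int[OF level_set_sets])
    fix x assume x: "x \<in> space G"
    let ?h = "\<lambda>N u. indicator (?E N u) x :: real"
    have h0: "?h N u = 0" if "x \<notin> vI m N u" for N u using that by simp
    show "(\<Sum>N\<le>L. \<Sum>u\<in>reps N. if stops c N u then ?h N u else 0) \<le> indicator (level_set c) x"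
    proof (cases "good c L x")
      case True
      have "(\<Sum>N\<le>L. \<Sum>u\<in>reps N. if stops c N u then ?h N u else 0) = 0"
        by (rule sum_stops_good[OF x True]) (rule h0)
      then show ?thesis by simp
    next
      case False
      then obtain N where N: "N \<le> L" "stops c N x" by (rule not_good_imp_stops)
      have "(\<Sum>N\<le>L. \<Sum>u\<in>reps N. if stops c N u then ?h N u else 0) = ?h N (trunc N x)"
        by (rule sum_stops[OF x N(2,1)]) (rule h0)
      also have "\<dots> \<le> indicator (level_set c) x" by (simp add: indicator_def)
      finally show ?thesis .
    qed
  qed auto
  also have "\<dots> = real B * measure G (level_set c)"
    using sets.sets_into_space[OF level_set_sets] by (simp add: Int_absorb2)
  finally show ?thesis .
qed

end

subsection \<open>The maximal inequality at a finite level\<close>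

lemma fmean_cong: "(\<And>t. t \<in> space G \<Longrightarrow> F t = F' t) \<Longrightarrow> fmean F n x = fmean F' n x"
  unfolding fmean_def by (intro arg_cong2[where f = "(/)"] Bochner_Integration.integral_cong refl) auto

lemma sqrt_norm_fmean_sum_le:
  assumes "\<And>i. i \<in> I \<Longrightarrow> depends L (F i)" "n \<le> M L"
  shows "sqrt (norm (fmean (\<lambda>t. \<Sum>i\<in>I. F i t) n x)) \<le> (\<Sum>i\<in>I. sqrt (norm (fmean (F i) n x)))"
proof -
  have "sqrt (norm (fmean (\<lambda>t. \<Sum>i\<in>I. F i t) n x)) \<le> sqrt (\<Sum>i\<in>I. norm (fmean (F i) n x))"
  proof (rule real_sqrt_le_mono)
    have "fmean (\<lambda>t. \<Sum>i\<in>I. F i t) n x = (\<Sum>i\<in>I. fmean (F i) n x)"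
      by (rule fmean_sum[OF assms])
    then show "norm (fmean (\<lambda>t. \<Sum>i\<in>I. F i t) n x) \<le> (\<Sum>i\<in>I. norm (fmean (F i) n x))"
      by (simp only: norm_sum)
  qed
  also have "\<dots> \<le> (\<Sum>i\<in>I. sqrt (norm (fmean (F i) n x)))"
    by (rule sqrt_sum_le) simp
  finally show ?thesis .
qed

text \<open>The product of 8 B^3 from \<open>sqrt_fmean_atom_le\<close>, \<open>sqrt 5\<close> from
  the size c + 4 c of an atom, 1 + 3 B from \<open>integral_atom_weight_le\<close>, B from
  \<open>sum_stop_cells_le\<close> and 2 from \<open>sum_level_sets_le\<close>.\<close>

definition max_const :: real where
  "max_const = 16 * real B ^ 4 * (1 + 3 * real B) * sqrt 5"

lemma max_const_nonneg: "max_const \<ge> 0"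
  by (simp add: max_const_def)

context
  fixes f :: "nat \<Rightarrow> (nat \<Rightarrow> nat) \<Rightarrow> complex" and L :: nat
  assumes f: "vmartingale m f"
begin

definition max_upto :: "(nat \<Rightarrow> nat) \<Rightarrow> real" where
  "max_upto x = Max ((\<lambda>n. norm (f n x)) ` {..L})"

lemma max_upto_nonneg: "max_upto x \<ge> 0"
  unfolding max_upto_def by (subst Max_ge_iff) auto

lemma depends_max_upto: "depends L max_upto"
proof (rule dependsI)
  fix x y assume xy: "x \<in> space G" "y \<in> space G" "\<And>i. i < L \<Longrightarrow> x i = y i"
  have "f n x = f n y" if "n \<le> L" for n
    by (rule dependsD[OF depends_mono[OF depends_f[OF f] that] xy])
  then show "max_upto x = max_upto y" by (simp add: max_upto_def)
qed

lemma mem_level_set_iff: "x \<in> level_set f L c \<longleftrightarrow> x \<in> space G \<and> c < max_upto x"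
  by (auto simp: level_set_def[OF f] max_upto_def Max_gr_iff)

lemma sum_level_sets_le:
  assumes e: "e > 0"
  shows "(\<Sum>i<K. sqrt (e * 4 ^ i) * measure G (level_set f L (e * 4 ^ i))) \<le> 2 * (\<integral>x. sqrt (max_upto x) \<partial>G)"
proof -
  let ?E = "\<lambda>i. level_set f L (e * 4 ^ i)"
  have sets: "?E i \<in> sets G" for i by (rule level_set_sets[OF f])
  have int: "integrable G (indicator (?E i) :: _ \<Rightarrow> real)" for i
    using sets by (intro integrable_real_indicator) (auto simp: emeasure_G)
  have "(\<Sum>i<K. sqrt (e * 4 ^ i) * measure G (?E i)) = (\<Sum>i<K. \<integral>x. sqrt (e * 4 ^ i) * indicator (?E i) x \<partial>G)"
    using sets.sets_into_space[OF sets]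
    by (intro sum.cong refl) (simp only: integral_mult_right_zero Bochner_Integration.integral_indicator Int_absorb2)
  also have "\<dots> = (\<integral>x. (\<Sum>i<K. sqrt (e * 4 ^ i) * indicator (?E i) x) \<partial>G)"
    by (intro Bochner_Integration.integral_sum[symmetric] integrable_mult_right int)
  also have "\<dots> \<le> (\<integral>x. 2 * sqrt (max_upto x) \<partial>G)"
  proof (rule integral_mono)
    show "integrable G (\<lambda>x. \<Sum>i<K. sqrt (e * 4 ^ i) * indicator (?E i) x)"
      by (intro Bochner_Integration.integrable_sum integrable_mult_right int)
    show "integrable G (\<lambda>x. 2 * sqrt (max_upto x))"
      by (rule depends_integrable[OF depends_comp[OF depends_max_upto]])
    fix x assume x: "x \<in> space G"
    define z where "z = sqrt (max_upto x) / sqrt e"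
    have z: "z \<ge> 0" using max_upto_nonneg e by (simp add: z_def)
    have sqrt4: "sqrt (e * 4 ^ i) = sqrt e * 2 ^ i" for i
    proof -
      have "sqrt (4 ^ i) = (2 :: real) ^ i"
        by (rule real_sqrt_unique) (auto simp: power2_eq_square simp flip: power_mult_distrib)
      then show ?thesis by (simp add: real_sqrt_mult)
    qed
    have iff: "x \<in> ?E i \<longleftrightarrow> 2 ^ i < z" for i
    proof -
      have "x \<in> ?E i \<longleftrightarrow> sqrt (e * 4 ^ i) < sqrt (max_upto x)"
        using x by (simp add: mem_level_set_iff)
      also have "\<dots> \<longleftrightarrow> 2 ^ i < z"
        unfolding sqrt4 z_def using e by (simp add: pos_less_divide_eq mult.commute)
      finally show ?thesis .
    qed
    have "(\<Sum>i<K. sqrt (e * 4 ^ i) * indicator (?E i) x) = sqrt e * (\<Sum>i<K. if 2 ^ i < z then 2 ^ i else 0)"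
      unfolding sum_distrib_left by (intro sum.cong refl) (simp add: sqrt4 indicator_def iff)
    also have "\<dots> \<le> sqrt e * (2 * z)"
      using e by (intro mult_left_mono sum_powers_below_le z) auto
    also have "\<dots> = 2 * sqrt (max_upto x)" using e by (simp add: z_def)
    finally show "(\<Sum>i<K. sqrt (e * 4 ^ i) * indicator (?E i) x) \<le> 2 * sqrt (max_upto x)" .
  qed
  finally show ?thesis by simp
qed

text \<open>f 0, ..., f L take finitely many values altogether, so from some level on nothing is
  stopped and the decomposition is a finite sum.\<close>

lemma exists_good_level:
  assumes e: "e > 0"
  obtains K where "\<And>x. x \<in> space G \<Longrightarrow> good f (e * 4 ^ K) L x"
proof -
  have "\<forall>n. \<exists>C. \<forall>x\<in>space G. norm (f n x) \<le> C"
  proof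
    fix n
    show "\<exists>C. \<forall>x\<in>space G. norm (f n x) \<le> C"
      by (rule depends_bounded[OF depends_f[OF f, of n]]) blast
  qed
  then obtain C where C: "\<And>n x. x \<in> space G \<Longrightarrow> norm (f n x) \<le> C n"
    unfolding choice_iff by blast
  obtain K where K: "(\<Sum>n\<le>L. \<bar>C n\<bar>) / e < 4 ^ K"
    using real_arch_pow[of 4 "(\<Sum>n\<le>L. \<bar>C n\<bar>) / e"] by auto
  have "good f (e * 4 ^ K) L x" for x
    unfolding good_def[OF f]
  proof (intro allI impI ballI)
    fix n y assume n: "n \<le> L" and y: "y \<in> vI m (n - 1) x"
    have "norm (f n y) \<le> \<bar>C n\<bar>" using C[of y n] y by (simp add: vI_def)
    also have "\<dots> \<le> (\<Sum>n\<le>L. \<bar>C n\<bar>)" using n by (intro member_le_sum) auto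
    also have "\<dots> \<le> e * 4 ^ K" using K e by (simp add: divide_less_eq mult.commute)
    finally show "norm (f n y) \<le> e * 4 ^ K" .
  qed
  then show ?thesis using that by blast
qed

definition piece :: "real \<Rightarrow> nat \<Rightarrow> nat \<Rightarrow> (nat \<Rightarrow> nat) \<Rightarrow> (nat \<Rightarrow> nat) \<Rightarrow> complex" where
  "piece e i N u t = (if stops f L (e * 4 ^ i) N u
     then of_bool (t \<in> vI m N u) * increment f L (e * 4 ^ i) (e * 4 ^ Suc i) t else 0)"

text \<open>The summands do not depend on n, so one integral controls the supremum over n.\<close>

definition majorant :: "real \<Rightarrow> nat \<Rightarrow> (nat \<Rightarrow> nat) \<Rightarrow> real" where
  "majorant e K x = (\<Sum>i<K. \<Sum>N\<le>L. \<Sum>u\<in>reps N. if stops f L (e * 4 ^ i) N u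
     then 8 * real B ^ 3 * sqrt (5 * (e * 4 ^ i)) * atom_weight N u x else 0)"

lemma depends_piece:
  assumes "N \<le> L"
  shows "depends L (piece e i N u)"
proof (cases "stops f L (e * 4 ^ i) N u")
  case True
  have "depends L (\<lambda>t. of_bool (t \<in> vI m N u) * increment f L (e * 4 ^ i) (e * 4 ^ Suc i) t)"
    by (rule depends_comp2[where g = "\<lambda>x. x \<in> vI m N u" and h = "\<lambda>a b. of_bool a * b",
        OF depends_mono[OF depends_vI assms] depends_increment[OF f]])
  moreover have "piece e i N u = (\<lambda>t. of_bool (t \<in> vI m N u) * increment f L (e * 4 ^ i) (e * 4 ^ Suc i) t)"
    using True by (auto simp: piece_def)
  ultimately show ?thesis by simp
next
  case False
  then have "piece e i N u = (\<lambda>t. 0)" by (auto simp: piece_def)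
  then show ?thesis by (simp add: depends_const)
qed

lemma sqrt_fmean_piece_le:
  assumes e: "e > 0" and n: "1 \<le> n" "n \<le> M L" and x: "x \<in> space G" and N: "N \<le> L" and u: "u \<in> reps N"
  shows "sqrt (norm (fmean (piece e i N u) n x)) / ln (real n + 1) \<le>
    (if stops f L (e * 4 ^ i) N u then 8 * real B ^ 3 * sqrt (5 * (e * 4 ^ i)) * atom_weight N u x else 0)"
proof (cases "stops f L (e * 4 ^ i) N u")
  case True
  have "atom L N u (e * 4 ^ i + e * 4 ^ Suc i)
      (\<lambda>t. of_bool (t \<in> vI m N u) * increment f L (e * 4 ^ i) (e * 4 ^ Suc i) t)"
    using e by (intro atom_increment[OF f reps_space[OF u] N True]) auto
  moreover have "e * 4 ^ i + e * 4 ^ Suc i = 5 * (e * 4 ^ i)" by simp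
  moreover have "piece e i N u = (\<lambda>t. of_bool (t \<in> vI m N u) * increment f L (e * 4 ^ i) (e * 4 ^ Suc i) t)"
    using True by (auto simp: piece_def)
  ultimately have "atom L N u (5 * (e * 4 ^ i)) (piece e i N u)" by simp
  from sqrt_fmean_atom_le[OF this n x] show ?thesis using True by simp
next
  case False
  then have "piece e i N u = (\<lambda>t. 0)" by (auto simp: piece_def)
  then show ?thesis using False by (simp add: fmean_def)
qed

text \<open>The increments telescope from the martingale stopped at \<open>e\<close> to the one
  stopped at \<open>e * 4 ^ K\<close>, which is f L itself. The first summand on the right is the
  bottom part, bounded through \<open>norm_fmean_le\<close>, n <= M_L and ln (n + 1) >= 1/2.\<close>

lemma sqrt_vsigma_le:
  assumes e: "e > 0" and K: "\<And>t. t \<in> space G \<Longrightarrow> good f (e * 4 ^ K) L t"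
    and n: "1 \<le> n" "n \<le> M L" and x: "x \<in> space G"
  shows "sqrt (norm (vsigma m f n x)) / ln (real n + 1) \<le> 2 * sqrt (e * real (M L)) + majorant e K x"
proof -
  have ln: "ln (real n + 1) \<ge> 1 / 2"
  proof -
    have "(1 / 2 :: real) \<le> ln 2" using ln2_ge_two_thirds by simp
    also have "\<dots> \<le> ln (real n + 1)" using n by (intro iffD2[OF ln_le_cancel_iff]) auto
    finally show ?thesis .
  qed
  have decomp: "f L t = stopped f e L t + (\<Sum>i<K. \<Sum>N\<le>L. \<Sum>u\<in>reps N. piece e i N u t)" if t: "t \<in> space G" for t
  proof -
    have "(\<Sum>i<K. \<Sum>N\<le>L. \<Sum>u\<in>reps N. piece e i N u t) = (\<Sum>i<K. increment f L (e * 4 ^ i) (e * 4 ^ Suc i) t)"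
      using e by (intro sum.cong refl) (subst increment_decomposition[OF f t], auto simp: piece_def)
    also have "\<dots> = stopped f (e * 4 ^ K) L t - stopped f (e * 4 ^ 0) L t"
      unfolding increment_def[OF f] by (rule sum_lessThan_telescope)
    finally show ?thesis using good_imp_stopped_eq[OF f K[OF t]] by simp
  qed
  have d: "depends L (\<lambda>t. \<Sum>N\<le>L. \<Sum>u\<in>reps N. piece e i N u t)" for i
    by (intro depends_sum depends_piece) auto
  have "vsigma m f n x = fmean (\<lambda>t. stopped f e L t + (\<Sum>i<K. \<Sum>N\<le>L. \<Sum>u\<in>reps N. piece e i N u t)) n x"
    unfolding vsigma_eq_fmean[OF f n(2)] by (rule fmean_cong[OF decomp])
  also have "\<dots> = fmean (stopped f e L) n x + fmean (\<lambda>t. \<Sum>i<K. \<Sum>N\<le>L. \<Sum>u\<in>reps N. piece e i N u t) n x"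
    by (rule fmean_add[OF depends_stopped[OF f] depends_sum[OF d] n(2)])
  finally have eq: "vsigma m f n x = \<dots>" .
  have 1: "sqrt (norm (fmean (stopped f e L) n x)) \<le> sqrt (e * real (M L))"
  proof (rule real_sqrt_le_mono)
    have "norm (fmean (stopped f e L) n x) \<le> e * real n"
      using e by (intro norm_fmean_le[OF depends_stopped[OF f] n(2) norm_stopped_le[OF f] x]) auto
    also have "\<dots> \<le> e * real (M L)" using e n by (intro mult_left_mono) auto
    finally show "norm (fmean (stopped f e L) n x) \<le> e * real (M L)" .
  qed
  have 2: "sqrt (norm (fmean (\<lambda>t. \<Sum>i<K. \<Sum>N\<le>L. \<Sum>u\<in>reps N. piece e i N u t) n x))
      \<le> (\<Sum>i<K. \<Sum>N\<le>L. \<Sum>u\<in>reps N. sqrt (norm (fmean (piece e i N u) n x)))"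
    (is "?S \<le> ?T")
  proof -
    have "?S \<le> (\<Sum>i<K. sqrt (norm (fmean (\<lambda>t. \<Sum>N\<le>L. \<Sum>u\<in>reps N. piece e i N u t) n x)))"
      by (rule sqrt_norm_fmean_sum_le[OF d n(2)])
    also have "\<dots> \<le> (\<Sum>i<K. \<Sum>N\<le>L. sqrt (norm (fmean (\<lambda>t. \<Sum>u\<in>reps N. piece e i N u t) n x)))"
      by (intro sum_mono sqrt_norm_fmean_sum_le[OF depends_sum n(2)] depends_piece) auto
    also have "\<dots> \<le> ?T"
      by (intro sum_mono sqrt_norm_fmean_sum_le[OF depends_piece n(2)]) auto
    finally show ?thesis .
  qed
  have "sqrt (norm (vsigma m f n x)) \<le> sqrt (norm (fmean (stopped f e L) n x)) + ?S"
    unfolding eq by (intro order_trans[OF real_sqrt_le_mono[OF norm_triangle_ineq]] sqrt_add_le_add_sqrt) auto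
  also have "\<dots> \<le> sqrt (e * real (M L)) + ?T" by (rule add_mono[OF 1 2])
  finally have "sqrt (norm (vsigma m f n x)) / ln (real n + 1) \<le> (sqrt (e * real (M L)) + ?T) / ln (real n + 1)"
    using ln by (intro divide_right_mono) auto
  also have "\<dots> = sqrt (e * real (M L)) / ln (real n + 1) +
      (\<Sum>i<K. \<Sum>N\<le>L. \<Sum>u\<in>reps N. sqrt (norm (fmean (piece e i N u) n x)) / ln (real n + 1))"
    by (simp only: add_divide_distrib sum_divide_distrib)
  also have "\<dots> \<le> 2 * sqrt (e * real (M L)) + majorant e K x"
  proof (rule add_mono)
    have "sqrt (e * real (M L)) / ln (real n + 1) \<le> sqrt (e * real (M L)) / (1 / 2)"
      using e ln n by (intro divide_left_mono) auto
    then show "sqrt (e * real (M L)) / ln (real n + 1) \<le> 2 * sqrt (e * real (M L))" by simp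
    show "(\<Sum>i<K. \<Sum>N\<le>L. \<Sum>u\<in>reps N. sqrt (norm (fmean (piece e i N u) n x)) / ln (real n + 1)) \<le> majorant e K x"
      unfolding majorant_def by (intro sum_mono sqrt_fmean_piece_le[OF e n x]) auto
  qed
  finally show ?thesis .
qed

lemma
  assumes e: "e > 0"
  shows integrable_majorant: "integrable G (majorant e K)"
    and integral_majorant_le: "(\<integral>x. majorant e K x \<partial>G) \<le> max_const * (\<integral>x. sqrt (max_upto x) \<partial>G)"
    and majorant_nonneg: "majorant e K x \<ge> 0"
proof -
  let ?c = "\<lambda>i. 8 * real B ^ 3 * sqrt (5 * (e * 4 ^ i))"
  let ?t = "\<lambda>i N u x. if stops f L (e * 4 ^ i) N u then ?c i * atom_weight N u x else 0"
  have int: "integrable G (?t i N u)" if "u \<in> reps N" for i N u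
    using integrable_atom_weight[OF reps_space[OF that], of N] by (cases "stops f L (e * 4 ^ i) N u") auto
  show "integrable G (majorant e K)"
    unfolding majorant_def by (intro Bochner_Integration.integrable_sum int)
  show "majorant e K x \<ge> 0"
    unfolding majorant_def using e atom_weight_nonneg by (intro sum_nonneg) auto
  have "(\<integral>x. majorant e K x \<partial>G) = (\<Sum>i<K. \<integral>x. (\<Sum>N\<le>L. \<Sum>u\<in>reps N. ?t i N u x) \<partial>G)"
    unfolding majorant_def by (intro Bochner_Integration.integral_sum Bochner_Integration.integrable_sum int)
  also have "\<dots> = (\<Sum>i<K. \<Sum>N\<le>L. \<integral>x. (\<Sum>u\<in>reps N. ?t i N u x) \<partial>G)"
    by (intro sum.cong refl Bochner_Integration.integral_sum Bochner_Integration.integrable_sum int)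
  also have "\<dots> = (\<Sum>i<K. \<Sum>N\<le>L. \<Sum>u\<in>reps N. \<integral>x. ?t i N u x \<partial>G)"
    by (intro sum.cong refl Bochner_Integration.integral_sum int)
  also have "\<dots> \<le> (\<Sum>i<K. \<Sum>N\<le>L. \<Sum>u\<in>reps N. (?c i * (1 + 3 * real B)) * (if stops f L (e * 4 ^ i) N u then measure G (vI m N u) else 0))"
  proof (intro sum_mono)
    fix i N u assume u: "u \<in> reps N"
    have "?c i * (\<integral>x. atom_weight N u x \<partial>G) \<le> ?c i * ((1 + 3 * real B) * measure G (vI m N u))"
      using e by (intro mult_left_mono integral_atom_weight_le reps_space[OF u]) auto
    then show "(\<integral>x. ?t i N u x \<partial>G) \<le> (?c i * (1 + 3 * real B)) * (if stops f L (e * 4 ^ i) N u then measure G (vI m N u) else 0)"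
      by (cases "stops f L (e * 4 ^ i) N u") (simp_all add: mult.assoc)
  qed
  also have "\<dots> = (\<Sum>i<K. (?c i * (1 + 3 * real B)) * (\<Sum>N\<le>L. \<Sum>u\<in>reps N. if stops f L (e * 4 ^ i) N u then measure G (vI m N u) else 0))"
    by (simp only: sum_distrib_left)
  also have "\<dots> \<le> (\<Sum>i<K. (?c i * (1 + 3 * real B)) * (real B * measure G (level_set f L (e * 4 ^ i))))"
    using e by (intro sum_mono mult_left_mono sum_stop_cells_le[OF f]) auto
  also have "\<dots> = (8 * real B ^ 4 * (1 + 3 * real B) * sqrt 5) * (\<Sum>i<K. sqrt (e * 4 ^ i) * measure G (level_set f L (e * 4 ^ i)))"
    unfolding sum_distrib_left by (intro sum.cong refl) (simp add: real_sqrt_mult eval_nat_numeral)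
  also have "\<dots> \<le> (8 * real B ^ 4 * (1 + 3 * real B) * sqrt 5) * (2 * (\<integral>x. sqrt (max_upto x) \<partial>G))"
    by (intro mult_left_mono sum_level_sets_le e) auto
  also have "\<dots> = max_const * (\<integral>x. sqrt (max_upto x) \<partial>G)"
    by (simp add: max_const_def)
  finally show "(\<integral>x. majorant e K x \<partial>G) \<le> max_const * (\<integral>x. sqrt (max_upto x) \<partial>G)" .
qed

text \<open>As L is fixed, \<open>e\<close> can be chosen to make the bottom error 2 sqrt (e M_L)
  equal to any d > 0, while the bound on the integral of \<open>majorant\<close> involves neither
  \<open>e\<close> nor \<open>K\<close>.\<close>

lemma finite_level_maximal_inequality:
  "(\<integral>\<^sup>+x. (SUP n\<in>{1..M L}. ennreal (sqrt (norm (vsigma m f n x)) / ln (real n + 1))) \<partial>G)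
    \<le> ennreal max_const * (\<integral>\<^sup>+x. ennreal (sqrt (max_upto x)) \<partial>G)"
proof (rule ennreal_le_epsilon)
  fix d :: real assume d: "d > 0"
  define e where "e = (d / 2)\<^sup>2 / real (M L)"
  have e: "e > 0" using d by (simp add: e_def)
  have sq: "2 * sqrt (e * real (M L)) = d" using d by (simp add: e_def real_sqrt_divide)
  obtain K where K: "\<And>x. x \<in> space G \<Longrightarrow> good f (e * 4 ^ K) L x"
    using exists_good_level[OF e] by blast
  interpret P: prob_space G by (rule prob_space_G)
  have int: "integrable G (\<lambda>x. sqrt (max_upto x))"
    by (rule depends_integrable[OF depends_comp[OF depends_max_upto]])
  have "(\<integral>\<^sup>+x. (SUP n\<in>{1..M L}. ennreal (sqrt (norm (vsigma m f n x)) / ln (real n + 1))) \<partial>G)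
      \<le> (\<integral>\<^sup>+x. ennreal (d + majorant e K x) \<partial>G)"
  proof (rule nn_integral_mono, rule SUP_least)
    fix x n assume "x \<in> space G" "n \<in> {1..M L}"
    then show "ennreal (sqrt (norm (vsigma m f n x)) / ln (real n + 1)) \<le> ennreal (d + majorant e K x)"
      using sqrt_vsigma_le[OF e K, of n x] sq by (intro ennreal_leI) auto
  qed
  also have "\<dots> = ennreal (\<integral>x. d + majorant e K x \<partial>G)"
    using d majorant_nonneg[OF e] integrable_majorant[OF e] by (intro nn_integral_eq_integral) (auto intro!: AE_I2 add_nonneg_nonneg)
  also have "\<dots> = ennreal (d + (\<integral>x. majorant e K x \<partial>G))"
    using integrable_majorant[OF e] by (simp add: P.prob_space)
  also have "\<dots> \<le> ennreal (d + max_const * (\<integral>x. sqrt (max_upto x) \<partial>G))"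
    using integral_majorant_le[OF e] by (intro ennreal_leI) auto
  also have "\<dots> = ennreal d + ennreal max_const * ennreal (\<integral>x. sqrt (max_upto x) \<partial>G)"
    using d max_const_nonneg max_upto_nonneg by (simp add: ennreal_plus ennreal_mult integral_nonneg)
  also have "ennreal (\<integral>x. sqrt (max_upto x) \<partial>G) = (\<integral>\<^sup>+x. ennreal (sqrt (max_upto x)) \<partial>G)"
    using int max_upto_nonneg by (intro nn_integral_eq_integral[symmetric]) auto
  finally show "(\<integral>\<^sup>+x. (SUP n\<in>{1..M L}. ennreal (sqrt (norm (vsigma m f n x)) / ln (real n + 1))) \<partial>G)
    \<le> ennreal max_const * (\<integral>\<^sup>+x. ennreal (sqrt (max_upto x)) \<partial>G) + ennreal d"
    by (simp only: add.commute)
qed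

end

section \<open>Passage to the full maximal functions\<close>

lemma sqrt_max_upto_le:
  assumes f: "vmartingale m f"
  shows "ennreal (sqrt (max_upto f L x)) \<le> enn_powr (vmax f x) (1 / 2)"
proof (cases "vmax f x = \<infinity>")
  case False
  have "max_upto f L x \<in> (\<lambda>n. norm (f n x)) ` {..L}"
    unfolding max_upto_def[OF f] by (intro Max_in) auto
  then obtain n where n: "max_upto f L x = norm (f n x)" by auto
  have "ennreal (max_upto f L x) \<le> vmax f x"
    unfolding n vmax_def by (rule SUP_upper) simp
  then have "max_upto f L x \<le> enn2real (vmax f x)"
    using False enn2real_mono[of "ennreal (max_upto f L x)" "vmax f x"] max_upto_nonneg[OF f]
    by (simp add: less_top)
  then have "sqrt (max_upto f L x) \<le> enn2real (vmax f x) powr (1 / 2)"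
    by (simp add: powr_half_sqrt)
  then show ?thesis using False by (simp add: enn_powr_def ennreal_leI)
qed (simp add: enn_powr_def)

lemma vsigma_measurable:
  assumes "n \<le> M L"
  shows "vsigma m f n \<in> borel_measurable G"
proof -
  have "depends L (\<lambda>x. \<Sum>k<n. \<Sum>i<k. vfourier m f i * vpsi m i x)"
  proof (intro depends_sum)
    fix k i assume "k \<in> {..<n}" "i \<in> {..<k}"
    then have "i < M L" using assms by simp
    then show "depends L (\<lambda>x. vfourier m f i * vpsi m i x)"
      by (rule depends_comp[OF depends_vpsi])
  qed
  from depends_borel[OF depends_comp[OF this, of "\<lambda>a. a / of_nat n"]] show ?thesis
    unfolding vsigma_def vS_def .
qed

text \<open>The suprema over n <= M_L increase with L and exhaust all n because n <= M_n. The
  finite-level bound is uniform in L, so monotone convergence applies.\<close>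

lemma maximal_inequality:
  assumes f: "vmartingale m f"
  shows "(\<integral>\<^sup>+x. enn_powr (vsigma_tilde m f x) (1 / 2) \<partial>G) \<le>
    ennreal max_const * (\<integral>\<^sup>+x. enn_powr (vmax f x) (1 / 2) \<partial>G)"
proof -
  let ?a = "\<lambda>n x. ennreal (sqrt (norm (vsigma m f n x)) / ln (real n + 1))"
  let ?g = "\<lambda>L x. SUP n\<in>{1..M L}. ?a n x"
  have "(\<integral>\<^sup>+x. enn_powr (vsigma_tilde m f x) (1 / 2) \<partial>G) \<le> (\<integral>\<^sup>+x. (SUP L. ?g L x) \<partial>G)"
  proof (rule nn_integral_mono)
    fix x
    show "enn_powr (vsigma_tilde m f x) (1 / 2) \<le> (SUP L. ?g L x)"
      unfolding vsigma_tilde_def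
    proof (rule enn_powr_half_SUP_le)
      fix n :: nat assume n: "n \<in> {1..}"
      have "n \<le> M n" using M_ge_power[of n] less_exp[of n] by linarith
      then have "?a n x \<le> ?g n x" using n by (intro SUP_upper) auto
      also have "\<dots> \<le> (SUP L. ?g L x)" by (intro SUP_upper) auto
      finally show "ennreal (sqrt (norm (vsigma m f n x) / (ln (real n + 1))\<^sup>2)) \<le> (SUP L. ?g L x)"
        by (simp add: real_sqrt_divide)
    qed simp
  qed
  also have "\<dots> = (SUP L. \<integral>\<^sup>+x. ?g L x \<partial>G)"
  proof (rule nn_integral_monotone_convergence_SUP)
    show "incseq (\<lambda>L x. ?g L x)"
    proof (intro monoI le_funI SUP_subset_mono order.refl)
      fix L L' :: nat assume "L \<le> L'"
      then show "{1..M L} \<subseteq> {1..M L'}" using M_mono by simp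
    qed
    fix L
    have meas: "?a n \<in> borel_measurable G" if "n \<in> {1..M L}" for n
    proof -
      have [measurable]: "vsigma m f n \<in> borel_measurable G" using that by (intro vsigma_measurable) auto
      show ?thesis by measurable
    qed
    then show "?g L \<in> borel_measurable G" by (intro borel_measurable_SUP) auto
  qed
  also have "\<dots> \<le> ennreal max_const * (\<integral>\<^sup>+x. enn_powr (vmax f x) (1 / 2) \<partial>G)"
  proof (rule SUP_least)
    fix L
    have "(\<integral>\<^sup>+x. ?g L x \<partial>G) \<le> ennreal max_const * (\<integral>\<^sup>+x. ennreal (sqrt (max_upto f L x)) \<partial>G)"
      by (rule finite_level_maximal_inequality[OF f])
    also have "\<dots> \<le> ennreal max_const * (\<integral>\<^sup>+x. enn_powr (vmax f x) (1 / 2) \<partial>G)"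
      by (intro mult_left_mono nn_integral_mono sqrt_max_upto_le[OF f]) auto
    finally show "(\<integral>\<^sup>+x. ?g L x \<partial>G) \<le> ennreal max_const * (\<integral>\<^sup>+x. enn_powr (vmax f x) (1 / 2) \<partial>G)" .
  qed
  finally show ?thesis .
qed

text \<open>The L_{1/2} quasi-norm is the square of the integral of the root, so the constant is
  squared; finiteness of the Hardy norm moves the computation into the reals.\<close>

lemma vLp_vsigma_tilde_le:
  assumes f: "vmartingale m f" and fin: "vHp m (1 / 2) f < \<infinity>"
  shows "vLp m (1 / 2) (vsigma_tilde m f) \<le> ennreal (max_const\<^sup>2) * vHp m (1 / 2) f"
proof -
  define X where "X = (\<integral>\<^sup>+x. enn_powr (vsigma_tilde m f x) (1 / 2) \<partial>G)"
  define Y where "Y = (\<integral>\<^sup>+x. enn_powr (vmax f x) (1 / 2) \<partial>G)"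
  have "Y \<noteq> \<infinity>"
    using fin unfolding vHp_def vLp_def Y_def[symmetric] by (auto simp: enn_powr_def)
  then obtain y where y: "Y = ennreal y" "y \<ge> 0" by (cases Y rule: ennreal_cases) auto
  have X: "X \<le> ennreal (max_const * y)"
    using maximal_inequality[OF f] y max_const_nonneg unfolding X_def[symmetric] Y_def[symmetric]
    by (simp add: ennreal_mult)
  then obtain x where x: "X = ennreal x" "x \<ge> 0" by (cases X rule: ennreal_cases) (auto simp: top_unique)
  have "x \<le> max_const * y" using X x y max_const_nonneg by (simp add: ennreal_le_iff)
  then have "x\<^sup>2 \<le> max_const\<^sup>2 * y\<^sup>2"
    using x by (metis power_mono power_mult_distrib)
  then have "ennreal (x\<^sup>2) \<le> ennreal (max_const\<^sup>2) * ennreal (y\<^sup>2)"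
    by (simp add: ennreal_leI flip: ennreal_mult)
  moreover have "vLp m (1 / 2) (vsigma_tilde m f) = ennreal (x\<^sup>2)"
    using x unfolding vLp_def X_def[symmetric] by (simp add: enn_powr_def)
  moreover have "vHp m (1 / 2) f = ennreal (y\<^sup>2)"
    using y unfolding vHp_def vLp_def Y_def[symmetric] by (simp add: enn_powr_def)
  ultimately show ?thesis by simp
qed

end

theorem theorem1:
  fixes m :: "nat \<Rightarrow> nat"
  assumes "\<And>k. m k \<ge> 2"
    and "\<exists>B. \<forall>k. m k \<le> B"
  shows "\<exists>c::real. \<forall>f. vmartingale m f \<and> vHp m (1/2) f < \<infinity> \<longrightarrow>
           vLp m (1/2) (vsigma_tilde m f) \<le> ennreal c * vHp m (1/2) f"
proof -
  obtain B where "\<And>k. m k \<le> B" using assms(2) by blast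
  then interpret vilenkin m B using assms(1) by unfold_locales
  show ?thesis using vLp_vsigma_tilde_le by blast
qed

end
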